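(* Let $G$ be a bipartite graph with $m$ left vertices and $n$ right vertices, let $\widehat G$ be its augmented bipartite graph, and let $\mathcal R_{\widehat G}\subset\mathbb R^{m+1}\oplus\mathbb R^{n+1}$ be the root polytope of $\widehat G$. Then the Ehrhart series of $\mathcal R_{\widehat G}$ is $$\operatorname{Ehr}_{\mathcal R_{\widehat G}}(z)=\frac{F_G(z)}{(1-z)^{m+n+1}},$$ where $F_G(z)=\sum_{\boldsymbol a\in D(G)}z^{s(\boldsymbol a)}$ is the support-enumerator of $G$. Equivalently, the $h^*$-polynomial of $\mathcal R_{\widehat G}$ is $h^*_{\mathcal R_{\widehat G}}(z)=F_G(z)$.
   Context: $G=(L\sqcup R,E)$ is a bipartite graph with left vertices $\ell_1,\dots,\ell_m$ and right vertices $r_1,\dots,r_n$; $[n]=\{1,\dots,n\}$; $I_j=\{i\in[n]\mid \ell_j \text{ is adjacent to } r_i\}$ for $j\in[m]$. A $G$-draconian sequence is a sequence $(a_1,\dots,a_m)$ of nonnegative integers such that $\sum_{i\in J}a_i\le|\bigcup_{i\in J}I_i|$ for every nonempty $J\subset[m]$. $D(G)$ is the set of all $G$-draconian sequences. For $\boldsymbol a\in\mathbb Z_{\ge0}^m$, $s(\boldsymbol a)$ is the number of positive coordinates of $\boldsymbol a$. The augmented bipartite graph $\widehat G$ is obtained from $G$ by adding a new left vertex $\ell_0$ and a new right vertex $r_0$, making $\ell_0$ adjacent to every right vertex $r_0,r_1,\dots,r_n$ and $r_0$ adjacent to every left vertex $\ell_0,\ell_1,\dots,\ell_m$; the edges of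 $G$ are kept. The root polytope of $\widehat G$ is $\mathcal R_{\widehat G}=\operatorname{conv}(\boldsymbol e_i+\boldsymbol f_j\mid(\ell_i,r_j)\text{ an edge of }\widehat G)\subset\mathbb R^{m+1}\oplus\mathbb R^{n+1}$, where $\boldsymbol e_0,\dots,\boldsymbol e_m$ and $\boldsymbol f_0,\dots,\boldsymbol f_n$ are the standard bases of $\mathbb R^{m+1}$ and $\mathbb R^{n+1}$. For a lattice polytope $P\subset\mathbb R^N$ of dimension $d$, $\operatorname{Ehr}_P(z)=\sum_{t\ge0}|tP\cap\mathbb Z^N|z^t$, and the $h^*$-polynomial $h^*_P(z)$ is the polynomial of degree at most $d$ with $\operatorname{Ehr}_P(z)=h^*_P(z)/(1-z)^{d+1}$. *)

theory Defs
  imports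
    "HOL-Analysis.Analysis"
    "HOL-Computational_Algebra.Polynomial_FPS"
    "HOL-Library.FuncSet"
begin

text \<open>
  A bipartite graph with left vertices \<open>\<ell>\<^sub>1, \<dots>, \<ell>\<^sub>m\<close> and right vertices
  \<open>r\<^sub>1, \<dots>, r\<^sub>n\<close> is given by \<open>m\<close>, \<open>n\<close> and its edge set \<open>E\<close>, where \<open>(j, i) \<in> E\<close> means
  that \<open>\<ell>\<^sub>j\<close> is adjacent to \<open>r\<^sub>i\<close>. The cases \<open>m = 0\<close> and \<open>n = 0\<close>, isolated vertices and
  disconnected graphs are all allowed.
\<close>

definition bipartite_graph :: "nat \<Rightarrow> nat \<Rightarrow> (nat \<times> nat) set \<Rightarrow> bool" where
  "bipartite_graph m n E \<longleftrightarrow> E \<subseteq> {1..m} \<times> {1..n}"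

definition neighbours :: "nat \<Rightarrow> (nat \<times> nat) set \<Rightarrow> nat \<Rightarrow> nat set" where
  "neighbours n E j = {i \<in> {1..n}. (j, i) \<in> E}"

text \<open>
  Sequences \<open>(a\<^sub>1, \<dots>, a\<^sub>m)\<close> are functions on \<open>{1..m}\<close>, made extensional so that distinct
  elements of the set below are distinct sequences.
\<close>

definition draconian_sequences :: "nat \<Rightarrow> nat \<Rightarrow> (nat \<times> nat) set \<Rightarrow> (nat \<Rightarrow> nat) set" where
  "draconian_sequences m n E =
     {a \<in> {1..m} \<rightarrow>\<^sub>E UNIV.
        \<forall>J. J \<noteq> {} \<and> J \<subseteq> {1..m} \<longrightarrow> (\<Sum>i\<in>J. a i) \<le> card (\<Union>i\<in>J. neighbours n E i)}"

text \<open>The sum defining the support-enumerator is therefore a genuine finite sum.\<close>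

lemma finite_draconian_sequences: "finite (draconian_sequences m n E)"
proof (rule finite_subset)
  show "draconian_sequences m n E \<subseteq> {1..m} \<rightarrow>\<^sub>E {..n}"
  proof
    fix a assume a: "a \<in> draconian_sequences m n E"
    have "a i \<le> n" if i: "i \<in> {1..m}" for i
    proof -
      have "(\<Sum>k\<in>{i}. a k) \<le> card (\<Union>k\<in>{i}. neighbours n E k)"
        using a i unfolding draconian_sequences_def by blast
      also have "\<dots> \<le> card {1..n}"
        by (rule card_mono) (auto simp: neighbours_def)
      finally show ?thesis by simp
    qed
    then show "a \<in> {1..m} \<rightarrow>\<^sub>E {..n}"
      using a by (auto simp: draconian_sequences_def PiE_iff)
  qed
qed (simp add: finite_PiE)

definition num_positive :: "nat \<Rightarrow> (nat \<Rightarrow> nat) \<Rightarrow> nat" where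
  "num_positive m a = card {i \<in> {1..m}. a i > 0}"

definition support_enumerator :: "nat \<Rightarrow> nat \<Rightarrow> (nat \<times> nat) set \<Rightarrow> real poly" where
  "support_enumerator m n E =
     (\<Sum>a\<in>draconian_sequences m n E. monom 1 (num_positive m a))"

definition augmented_edges :: "nat \<Rightarrow> nat \<Rightarrow> (nat \<times> nat) set \<Rightarrow> (nat \<times> nat) set" where
  "augmented_edges m n E = E \<union> {0} \<times> {0..n} \<union> {0..m} \<times> {0}"

text \<open>
  The direct sum of the two ambient spaces is their product, in which the vector
  \<open>e\<^sub>i + f\<^sub>j\<close> is the pair \<open>(e i, f j)\<close>. The arguments \<open>e\<close> and \<open>f\<close> are meant to
  enumerate the standard bases of the two spaces.
\<close>

definition root_polytope ::
    "(nat \<Rightarrow> 'a::euclidean_space) \<Rightarrow> (nat \<Rightarrow> 'b::euclidean_space) \<Rightarrow> (nat \<times> nat) set \<Rightarrow> ('a \<times> 'b) set" where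
  "root_polytope e f E = convex hull {(e i, f j) | i j. (i, j) \<in> E}"

definition lattice_points :: "'a::euclidean_space set" where
  "lattice_points = {x. \<forall>b\<in>Basis. x \<bullet> b \<in> \<int>}"

definition ehrhart_series :: "'a::euclidean_space set \<Rightarrow> real fps" where
  "ehrhart_series P = Abs_fps (\<lambda>t. real (card ((\<lambda>x. real t *\<^sub>R x) ` P \<inter> lattice_points)))"

text \<open>Meaningful for nonempty lattice polytopes, whose dimension \<open>d\<close> is \<open>aff_dim P\<close>.\<close>

definition hstar_polynomial :: "'a::euclidean_space set \<Rightarrow> real poly" where
  "hstar_polynomial P =
     (let d = nat (aff_dim P) in
      THE h. degree h \<le> d \<and> ehrhart_series P = fps_of_poly h / (1 - fps_X) ^ (d + 1))"

end

theory Submission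
  imports Defs
begin

text \<open>
  Call \<open>b\<close> a Hall vector of a bipartite graph if \<open>b(J) \<le> |N(J)|\<close> for all sets \<open>J\<close> of left vertices.
  A graph and its transpose have equally many Hall vectors. This is shown by deleting edges: a leaf
  gives the same recursion on both sides, and a graph without leaves contains a cycle, along which
  inclusion--exclusion over the deletions of alternate edges gives the same alternating sum on both sides.

  Lattice points of \<open>t\<close> times the root polytope are pairs \<open>(x, y)\<close> of degree vectors, and for a fixed \<open>x\<close> the
  admissible \<open>y\<close> are the Hall vectors of the transpose of the graph in which \<open>\<ell>\<^sub>j\<close> is replaced by \<open>x\<^sub>j\<close> copies.
  By duality they can be counted on the left side, where a Hall vector is a Hall vector \<open>a\<close> of the
  original graph with each \<open>a\<^sub>j\<close> split into \<open>x\<^sub>j\<close> parts. Summation over \<open>x\<close> turns position \<open>j\<close> into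
  \<open>z\<^bsup>[a\<^sub>j > 0]\<^esup> / (1 - z)\<^bsup>a\<^sub>j + 1\<^esup>\<close>, and summation over \<open>a\<^sub>0\<close> telescopes.
\<close>

section \<open>Hall vectors and tight sets\<close>

text \<open>Singletons \<open>J\<close> force a Hall vector to vanish outside the domain of \<open>E\<close>, so no carrier is needed.\<close>

definition hall_vectors :: "('a \<times> 'b) set \<Rightarrow> ('a \<Rightarrow> nat) set" where
  "hall_vectors E = {b. \<forall>J. finite J \<longrightarrow> sum b J \<le> card (E `` J)}"

lemma hall_vectorsD: "b \<in> hall_vectors E \<Longrightarrow> finite J \<Longrightarrow> sum b J \<le> card (E `` J)"
  by (simp add: hall_vectors_def)

lemma hall_vectors_mono:
  assumes "finite E" "E' \<subseteq> E"
  shows "hall_vectors E' \<subseteq> hall_vectors E"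
proof
  fix b assume b: "b \<in> hall_vectors E'"
  have "sum b J \<le> card (E `` J)" if "finite J" for J
    using hall_vectorsD[OF b that] card_mono[OF finite_Image[OF assms(1)], of "E' `` J" J] assms(2)
    by (meson Image_mono order_refl order_trans)
  then show "b \<in> hall_vectors E" by (simp add: hall_vectors_def)
qed

lemma hall_vectors_zero:
  assumes "b \<in> hall_vectors E" "a \<notin> Domain E"
  shows "b a = 0"
proof -
  have "E `` {a} = {}" using assms(2) by auto
  then show ?thesis using hall_vectorsD[OF assms(1), of "{a}"] by simp
qed

lemma finite_hall_vectors:
  assumes "finite E"
  shows "finite (hall_vectors E)"
proof (rule finite_subset)
  let ?N = "card (Range E)"
  show "hall_vectors E \<subseteq> {b. \<forall>a. (a \<in> Domain E \<longrightarrow> b a \<in> {..?N}) \<and> (a \<notin> Domain E \<longrightarrow> b a = 0)}"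
  proof safe
    fix b a assume b: "b \<in> hall_vectors E"
    have "b a \<le> card (E `` {a})" using hall_vectorsD[OF b, of "{a}"] by simp
    also have "\<dots> \<le> ?N" using assms by (intro card_mono) (auto simp: finite_Range)
    finally show "b a \<le> ?N" .
  qed (auto intro: hall_vectors_zero)
  show "finite {b. \<forall>a. (a \<in> Domain E \<longrightarrow> b a \<in> {..?N}) \<and> (a \<notin> Domain E \<longrightarrow> b a = 0)}"
    using assms by (intro finite_set_of_finite_funs) (auto simp: finite_Domain)
qed

text \<open>Otherwise submodularity of \<open>J \<mapsto> |E `` J|\<close> would be strict at two tight sets.\<close>

lemma tight_Int:
  assumes "finite E" "b \<in> hall_vectors E" "finite J" "finite K"
    and "sum b J = card (E `` J)" "sum b K = card (E `` K)"
    and "r \<in> E `` J" "r \<in> E `` K"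
  shows "r \<in> E `` (J \<inter> K)"
proof (rule ccontr)
  assume r: "r \<notin> E `` (J \<inter> K)"
  have "card (E `` (J \<inter> K)) < card (E `` J \<inter> E `` K)"
    using assms r by (intro psubset_card_mono) (auto simp: finite_Image)
  moreover have "card (E `` J) + card (E `` K) = card (E `` (J \<union> K)) + card (E `` J \<inter> E `` K)"
    using card_Un_Int[of "E `` J" "E `` K"] assms by (simp add: finite_Image Image_Un)
  moreover have "sum b (J \<union> K) \<le> card (E `` (J \<union> K))" "sum b (J \<inter> K) \<le> card (E `` (J \<inter> K))"
    using assms by (auto intro!: hall_vectorsD)
  moreover have "sum b (J \<union> K) + sum b (J \<inter> K) = sum b J + sum b K"
    using sum.union_inter[OF assms(3,4)] .
  ultimately show False using assms by linarith
qed

text \<open>Deleting one edge lowers the size of a neighbourhood by at most one, so a set violating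
  the condition afterwards was tight before, and the deleted edge was its only edge to
  \<open>r\<close>.\<close>

lemma needed_edge_tight:
  assumes "finite E" "b \<in> hall_vectors E" "b \<notin> hall_vectors (E - {(l, r)})"
  obtains J where "finite J" "sum b J = card (E `` J)" "l \<in> J" "(l, r) \<in> E" "r \<notin> (E - {(l, r)}) `` J"
proof -
  obtain J where J: "finite J" "card ((E - {(l, r)}) `` J) < sum b J"
    using assms(3) by (auto simp: hall_vectors_def not_le)
  have le: "sum b J \<le> card (E `` J)" using assms(2) J(1) by (rule hall_vectorsD)
  have sub: "E `` J \<subseteq> insert r ((E - {(l, r)}) `` J)" by auto
  have "E `` J \<noteq> (E - {(l, r)}) `` J" using J(2) le by auto
  then have *: "r \<notin> (E - {(l, r)}) `` J" "l \<in> J" "(l, r) \<in> E" by auto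
  have "card (E `` J) \<le> Suc (card ((E - {(l, r)}) `` J))"
    using card_mono[OF _ sub] assms(1) * by (simp add: finite_Image)
  with J le * that show thesis by (metis Suc_leI le_antisym order_trans)
qed

text \<open>Conversely, a tight set has no slack for losing the neighbour \<open>r\<close>.\<close>

lemma tight_needed_edge:
  assumes "finite E" "finite J" "sum b J = card (E `` J)" "l \<in> J" "(l, r) \<in> E" "r \<notin> (E - {(l, r)}) `` J"
  shows "b \<notin> hall_vectors (E - {(l, r)})"
proof
  assume "b \<in> hall_vectors (E - {(l, r)})"
  then have "sum b J \<le> card ((E - {(l, r)}) `` J)" using assms(2) by (rule hall_vectorsD)
  also have "\<dots> < card (E `` J)"
    using assms by (intro psubset_card_mono) (auto simp: finite_Image)
  finally show False using assms by simp
qed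

text \<open>Applied below to membership of \<open>l i\<close> in a tight set: it yields an index at
  which a path enters the set.\<close>

lemma first_change:
  fixes P :: "nat \<Rightarrow> bool"
  assumes "\<not> P p" "P q" "p \<le> q"
  obtains i where "p \<le> i" "i < q" "\<not> P i" "P (Suc i)"
proof -
  from assms(3,2) have "\<exists>i. p \<le> i \<and> i < q \<and> \<not> P i \<and> P (Suc i)"
  proof (induction q rule: dec_induct)
    case base with assms(1) show ?case by simp
  next
    case (step q) then show ?case by (metis less_Suc_eq order.refl)
  qed
  with that show thesis by blast
qed

section \<open>Inclusion--exclusion along a cycle\<close>

definition critical_vectors :: "('a \<times> 'b) set \<Rightarrow> ('a \<times> 'b) set \<Rightarrow> ('a \<Rightarrow> nat) set" where
  "critical_vectors E F = {b \<in> hall_vectors E. \<forall>\<epsilon>\<in>F. b \<notin> hall_vectors (E - {\<epsilon>})}"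

text \<open>A path \<open>l 0\<close>, \<open>r 0\<close>, \<open>l 1\<close>, \<open>r 1\<close>,
  ... whose alternate edges \<open>(l i, r i)\<close> are the ones to be deleted. The edge
  \<open>(l 0, r (k - 1))\<close> that closes it to a cycle is kept out, so that prefixes of chains
  are chains and induction on \<open>k\<close> is possible.\<close>

definition edge_chain :: "('a \<times> 'b) set \<Rightarrow> (nat \<Rightarrow> 'a) \<Rightarrow> (nat \<Rightarrow> 'b) \<Rightarrow> nat \<Rightarrow> bool" where
  "edge_chain E l r k \<longleftrightarrow> inj_on l {..<k} \<and> inj_on r {..<k} \<and> (\<forall>i<k. (l i, r i) \<in> E) \<and>
     (\<forall>i. Suc i < k \<longrightarrow> (l (Suc i), r i) \<in> E)"

lemma edge_chain_Suc:
  assumes "edge_chain E l r (Suc k)"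
  shows "edge_chain E l r k" "edge_chain (E - {(l k, r k)}) l r k"
proof -
  have "r i \<noteq> r k" if "i < k" for i
    using assms that unfolding edge_chain_def by (auto dest!: inj_onD[of r _ i k])
  with assms show "edge_chain (E - {(l k, r k)}) l r k"
    unfolding edge_chain_def by (auto simp: lessThan_Suc)
  show "edge_chain E l r k" using assms unfolding edge_chain_def by (auto simp: lessThan_Suc)
qed

text \<open>
  With \<open>?E = E - {\<epsilon>\<^sub>k}\<close>, the vector \<open>b\<close> needs each edge \<open>\<epsilon>\<^sub>j\<close> in \<open>E\<close>, by downward induction on \<open>j\<close>:
  a set \<open>J\<close> that is tight in \<open>?E\<close> but not in \<open>E\<close> contains \<open>l\<^sub>k\<close> but not \<open>l\<^bsub>j + 1\<^esub>\<close>, so somewhere between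
  them \<open>l\<^sub>i \<notin> J\<close> and \<open>l\<^bsub>i + 1\<^esub> \<in> J\<close>, and \<open>r\<^sub>i\<close> contradicts tightness of \<open>J\<close> and of the set that forces \<open>\<epsilon>\<^sub>i\<close>.
\<close>

lemma critical_vectors_step:
  assumes E: "finite E" and c: "edge_chain E l r (Suc k)"
  defines "F \<equiv> (\<lambda>i. (l i, r i)) ` {..<k}"
  shows "critical_vectors (E - {(l k, r k)}) F \<subseteq> critical_vectors E F"
proof
  fix b let ?E = "E - {(l k, r k)}"
  assume "b \<in> critical_vectors ?E F"
  then have b: "b \<in> hall_vectors ?E" and need: "\<And>i. i < k \<Longrightarrow> b \<notin> hall_vectors (?E - {(l i, r i)})"
    by (auto simp: critical_vectors_def F_def)
  have bE: "b \<in> hall_vectors E" using hall_vectors_mono[OF E, of ?E] b by auto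
  have fE: "finite ?E" using E by simp
  have inj: "l i \<noteq> l j" "r i \<noteq> r j" if "i < Suc k" "j < Suc k" "i \<noteq> j" for i j
    using c that unfolding edge_chain_def by (auto dest: inj_onD)
  have "b \<notin> hall_vectors (E - {(l j, r j)})" if "j < k" for j
    using that
  proof (induction "k - j" arbitrary: j rule: less_induct)
    case less
    obtain J where J: "finite J" "sum b J = card (?E `` J)" "l j \<in> J"
      "r j \<notin> (?E - {(l j, r j)}) `` J"
      using needed_edge_tight[OF fE b need[OF less.prems]] by metis
    show ?case
    proof (cases "E `` J = ?E `` J")
      case True
      have "r j \<notin> (E - {(l j, r j)}) `` J" using J(4) inj(2)[of j k] less.prems by auto
      then show ?thesis using tight_needed_edge[OF E J(1)] J True c less.prems
        unfolding edge_chain_def by auto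
    next
      case False
      then have lk: "l k \<in> J" by auto
      have "(l (Suc j), r j) \<in> ?E - {(l j, r j)}"
        using c less.prems inj(1)[of "Suc j" j] inj(2)[of j k] unfolding edge_chain_def by auto
      then have "l (Suc j) \<notin> J" using J(4) by auto
      then obtain i where i: "Suc j \<le> i" "i < k" "l i \<notin> J" "l (Suc i) \<in> J"
        using first_change[of "\<lambda>i. l i \<in> J" "Suc j" k] lk less.prems by (metis Suc_leI)
      have "b \<notin> hall_vectors (E - {(l i, r i)})"
        using less.hyps[of i] i less.prems by auto
      then obtain K where K: "finite K" "sum b K = card (E `` K)" "l i \<in> K"
        "r i \<notin> (E - {(l i, r i)}) `` K"
        using needed_edge_tight[OF E bE] by metis
      have "card (?E `` K) \<le> card (E `` K)"
        using E by (intro card_mono) (auto simp: finite_Image)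
      then have K': "sum b K = card (?E `` K)"
        using K(2) hall_vectorsD[OF b K(1)] by simp
      have ne: "r i \<noteq> r k" using inj i by auto
      have e: "(l i, r i) \<in> E" "(l (Suc i), r i) \<in> E" using c i unfolding edge_chain_def by auto
      have "r i \<in> ?E `` J" "r i \<in> ?E `` K" using i(4) K(3) ne e by auto
      then have "r i \<in> ?E `` (J \<inter> K)"
        using tight_Int[OF fE b J(1) K(1) J(2) K'] by blast
      then show ?thesis using K(4) i(3) by auto
    qed
  qed
  then show "b \<in> critical_vectors E F" using bE by (auto simp: critical_vectors_def F_def)
qed

text \<open>Split off the last edge. The vectors critical for all edges are those critical in
  \<open>E\<close> for the earlier ones, minus those critical for the earlier ones in the graph
  without the last edge. By \<open>critical_vectors_step\<close> the second set lies in the first,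
  so the cardinalities subtract.\<close>

lemma card_critical_vectors:
  assumes "finite E" "edge_chain E l r k"
  shows "int (card (critical_vectors E ((\<lambda>i. (l i, r i)) ` {..<k}))) =
    (\<Sum>S\<in>Pow ((\<lambda>i. (l i, r i)) ` {..<k}). (-1) ^ card S * int (card (hall_vectors (E - S))))"
  using assms
proof (induction k arbitrary: E)
  case 0
  then show ?case by (simp add: critical_vectors_def)
next
  case (Suc k)
  let ?\<epsilon> = "(l k, r k)" and ?F = "(\<lambda>i. (l i, r i)) ` {..<k}"
  let ?g = "\<lambda>E S. (-1) ^ card S * int (card (hall_vectors (E - S)))"
  have "r i \<noteq> r k" if "i < k" for i
    using Suc.prems(2) that unfolding edge_chain_def by (auto dest!: inj_onD[of r _ i k])
  then have nin: "?\<epsilon> \<notin> ?F" by fastforce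
  have ins: "(\<lambda>i. (l i, r i)) ` {..<Suc k} = insert ?\<epsilon> ?F" by (auto simp: lessThan_Suc)
  have fin: "finite (critical_vectors E F)" for F
    using finite_hall_vectors[OF Suc.prems(1)] by (simp add: critical_vectors_def)
  have sub: "critical_vectors (E - {?\<epsilon>}) ?F \<subseteq> critical_vectors E ?F"
    by (rule critical_vectors_step[OF Suc.prems])
  have "critical_vectors E (insert ?\<epsilon> ?F) = critical_vectors E ?F - critical_vectors (E - {?\<epsilon>}) ?F"
  proof (intro equalityI subsetI)
    fix b assume b: "b \<in> critical_vectors E ?F - critical_vectors (E - {?\<epsilon>}) ?F"
    \<comment> \<open>A vector that survives the loss of the last edge without being critical there
      could lose a further edge \<open>x\<close>; by monotonicity it could then lose
      \<open>x\<close> alone, against criticality in \<open>E\<close>.\<close>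
    have "b \<notin> hall_vectors (E - {?\<epsilon>})"
    proof
      assume "b \<in> hall_vectors (E - {?\<epsilon>})"
      then obtain x where "x \<in> ?F" "b \<in> hall_vectors (E - {?\<epsilon>} - {x})"
        using b by (auto simp: critical_vectors_def)
      then show False using b hall_vectors_mono[of "E - {x}" "E - {?\<epsilon>} - {x}"] Suc.prems(1)
        unfolding critical_vectors_def by auto
    qed
    then show "b \<in> critical_vectors E (insert ?\<epsilon> ?F)" using b by (auto simp: critical_vectors_def)
  qed (auto simp: critical_vectors_def)
  then have "int (card (critical_vectors E (insert ?\<epsilon> ?F))) =
      int (card (critical_vectors E ?F)) - int (card (critical_vectors (E - {?\<epsilon>}) ?F))"
    using card_Diff_subset[OF finite_subset[OF sub fin] sub] card_mono[OF fin sub] by simp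
  also have "\<dots> = sum (?g E) (Pow ?F) - sum (?g (E - {?\<epsilon>})) (Pow ?F)"
    using Suc.IH[OF Suc.prems(1) edge_chain_Suc(1)[OF Suc.prems(2)]]
      Suc.IH[OF _ edge_chain_Suc(2)[OF Suc.prems(2)]] Suc.prems(1)
    by (simp only: finite_Diff)
  also have "sum (?g (E - {?\<epsilon>})) (Pow ?F) = - sum (?g E) (insert ?\<epsilon> ` Pow ?F)"
  proof -
    have inj: "inj_on (insert \<epsilon>) (Pow F)" if "\<epsilon> \<notin> F" for \<epsilon> :: "'a \<times> 'b" and F
      using that by (auto simp: inj_on_def)
    \<comment> \<open>Adding the last edge to \<open>S\<close> flips the sign and turns a deletion
      from the smaller graph into one from \<open>E\<close>.\<close>
    have "?g E (insert ?\<epsilon> S) = - ?g (E - {?\<epsilon>}) S" if "S \<in> Pow ?F" for S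
    proof -
      have "finite S" "?\<epsilon> \<notin> S" using that nin by (auto intro: finite_subset)
      moreover have "E - insert ?\<epsilon> S = E - {?\<epsilon>} - S" by auto
      ultimately show ?thesis by simp
    qed
    then show ?thesis unfolding sum.reindex[OF inj[OF nin]] by (simp add: sum_negf)
  qed
  also have "sum (?g E) (Pow ?F) - - sum (?g E) (insert ?\<epsilon> ` Pow ?F) = sum (?g E) (Pow (insert ?\<epsilon> ?F))"
  proof -
    have "Pow ?F \<inter> insert ?\<epsilon> ` Pow ?F = {}" using nin by blast
    then show ?thesis by (simp add: Pow_insert sum.union_disjoint del: insert_subset)
  qed
  finally show ?case unfolding ins .
qed

text \<open>The tight set \<open>J\<close> forcing the last edge omits \<open>l 0\<close> because of
  the closing edge, so the path enters \<open>J\<close> between some \<open>l i\<close> and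
  \<open>l (Suc i)\<close>. The tight set \<open>K\<close> forcing the edge at \<open>i\<close>
  reaches \<open>r i\<close> only from \<open>l i\<close>. Hence \<open>r i\<close> is adjacent to
  both sets but not to their intersection, contradicting \<open>tight_Int\<close>.\<close>

lemma critical_vectors_cycle:
  assumes E: "finite E" and c: "edge_chain E l r k" and k: "2 \<le> k" and cl: "(l 0, r (k - 1)) \<in> E"
  shows "critical_vectors E ((\<lambda>i. (l i, r i)) ` {..<k}) = {}"
proof (rule ccontr)
  assume "\<not> ?thesis"
  then obtain b where b: "b \<in> hall_vectors E" and need: "\<And>i. i < k \<Longrightarrow> b \<notin> hall_vectors (E - {(l i, r i)})"
    by (auto simp: critical_vectors_def)
  have inj: "l i \<noteq> l j" if "i < k" "j < k" "i \<noteq> j" for i j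
    using c that unfolding edge_chain_def by (auto dest: inj_onD)
  obtain J where J: "finite J" "sum b J = card (E `` J)" "l (k - 1) \<in> J"
      "r (k - 1) \<notin> (E - {(l (k - 1), r (k - 1))}) `` J"
    using needed_edge_tight[OF E b need[of "k - 1"]] k by (metis diff_less less_le_trans zero_less_numeral zero_less_one)
  have "l 0 \<notin> J" using cl J(4) inj[of 0 "k - 1"] k by auto
  then obtain i where i: "i < k - 1" "l i \<notin> J" "l (Suc i) \<in> J"
    using first_change[of "\<lambda>i. l i \<in> J" 0 "k - 1"] J(3) by auto
  have i': "i < k" "Suc i < k" using i(1) by auto
  obtain K where K: "finite K" "sum b K = card (E `` K)" "l i \<in> K"
      "r i \<notin> (E - {(l i, r i)}) `` K"
    using needed_edge_tight[OF E b need[OF i'(1)]] by metis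
  have "(l i, r i) \<in> E" "(l (Suc i), r i) \<in> E" using i' c unfolding edge_chain_def by auto
  then have "r i \<in> E `` J" "r i \<in> E `` K" using i K(3) by auto
  then have "r i \<in> E `` (J \<inter> K)" using tight_Int[OF E b J(1) K(1) J(2) K(2)] by blast
  then show False using K(4) i(2) by auto
qed

text \<open>Traversed backwards, the path starts at a right vertex and is a chain of the transpose
  with the same alternate edges. Thus both sides of the duality sum over the same deletions.\<close>

lemma edge_chain_converse:
  assumes "edge_chain E l r k"
  shows "edge_chain (E\<inverse>) (\<lambda>i. r (k - 1 - i)) (\<lambda>i. l (k - 1 - i)) k"
proof -
  have inj: "inj_on (\<lambda>i. f (k - 1 - i)) {..<k}" if f: "inj_on f {..<k}" for f :: "nat \<Rightarrow> 'c"
  proof (rule inj_onI)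
    fix i j assume "i \<in> {..<k}" "j \<in> {..<k}" "f (k - 1 - i) = f (k - 1 - j)"
    then show "i = j" using inj_onD[OF f, of "k - 1 - i" "k - 1 - j"] by auto
  qed
  have "inj_on (\<lambda>i. l (k - 1 - i)) {..<k}" "inj_on (\<lambda>i. r (k - 1 - i)) {..<k}"
    using assms inj unfolding edge_chain_def by auto
  moreover have "(l (k - 1 - i), r (k - 1 - Suc i)) \<in> E" if "Suc i < k" for i
  proof -
    have "Suc (k - 1 - Suc i) = k - 1 - i" "Suc (k - 1 - Suc i) < k" using that by auto
    then show ?thesis using assms unfolding edge_chain_def by metis
  qed
  ultimately show ?thesis using assms unfolding edge_chain_def by auto
qed

text \<open>The alternating sums over the deleted sets \<open>S\<close> vanish for \<open>E\<close>
  and for its converse. By the induction hypothesis they agree in all terms with nonempty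
  \<open>S\<close>, hence also in the term for the empty set.\<close>

lemma card_hall_vectors_cycle:
  assumes E: "finite E" and c: "edge_chain E l r k" and k: "2 \<le> k" and cl: "(l 0, r (k - 1)) \<in> E"
    and IH: "\<And>E'. E' \<subset> E \<Longrightarrow> card (hall_vectors E') = card (hall_vectors (E'\<inverse>))"
  shows "card (hall_vectors E) = card (hall_vectors (E\<inverse>))"
proof -
  let ?F = "(\<lambda>i. (l i, r i)) ` {..<k}"
  let ?F' = "(\<lambda>i. (r (k - 1 - i), l (k - 1 - i))) ` {..<k}"
  have FE: "?F \<subseteq> E" using c by (auto simp: edge_chain_def)
  have F': "?F' = ?F\<inverse>"
  proof (intro equalityI subsetI)
    fix p assume "p \<in> ?F\<inverse>"
    then obtain i where "i < k" "p = (r i, l i)" by auto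
    then show "p \<in> ?F'" by (intro image_eqI[of _ _ "k - 1 - i"]) auto
  qed auto
  have 1: "(\<Sum>S\<in>Pow ?F. (-1) ^ card S * int (card (hall_vectors (E - S)))) = 0"
    using card_critical_vectors[OF E c] critical_vectors_cycle[OF E c k cl] by simp
  have "(r (k - 1 - 0), l (k - 1 - (k - 1))) \<in> E\<inverse>" using cl by simp
  then have "(\<Sum>S\<in>Pow ?F'. (-1) ^ card S * int (card (hall_vectors (E\<inverse> - S)))) = 0"
    using card_critical_vectors[OF _ edge_chain_converse[OF c]]
      critical_vectors_cycle[OF _ edge_chain_converse[OF c] k] E by simp
  moreover have "Pow ?F' = converse ` Pow ?F"
  proof -
    have "S \<in> converse ` Pow ?F" if "S \<subseteq> ?F\<inverse>" for S
      using that by (intro image_eqI[of _ _ "S\<inverse>"]) auto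
    then show ?thesis unfolding F' by auto
  qed
  moreover have "inj_on converse (Pow ?F)" by (auto simp: inj_on_def)
  ultimately have *: "(\<Sum>S\<in>Pow ?F. (-1) ^ card (S\<inverse>) * int (card (hall_vectors (E\<inverse> - S\<inverse>)))) = 0"
    by (simp add: sum.reindex)
  have 2: "(\<Sum>S\<in>Pow ?F. (-1) ^ card S * int (card (hall_vectors ((E - S)\<inverse>)))) = 0"
  proof -
    have "(E - S)\<inverse> = E\<inverse> - S\<inverse>" for S by auto
    then show ?thesis using * by (simp add: card_inverse)
  qed
  have "(\<Sum>S\<in>Pow ?F - {{}}. (-1) ^ card S * int (card (hall_vectors (E - S)))) =
        (\<Sum>S\<in>Pow ?F - {{}}. (-1) ^ card S * int (card (hall_vectors ((E - S)\<inverse>))))"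
  proof (rule sum.cong[OF refl])
    fix S assume "S \<in> Pow ?F - {{}}"
    then have "E - S \<subset> E" using FE by blast
    from IH[OF this] show "(-1) ^ card S * int (card (hall_vectors (E - S))) =
       (-1) ^ card S * int (card (hall_vectors ((E - S)\<inverse>)))" by simp
  qed
  with 1 2 show ?thesis
    by (simp add: sum.remove[of "Pow ?F" "{}"])
qed

section \<open>Duality\<close>

text \<open>As \<open>r\<close> is adjacent to \<open>l\<close> only, it adds exactly one to the
  neighbourhood of each set containing \<open>l\<close>. Lowering a positive \<open>b l\<close> by
  one thus gives the Hall vectors without the edge, and \<open>b l = 0\<close> gives those without
  the vertex \<open>l\<close>.\<close>

lemma card_hall_vectors_leaf:
  assumes E: "finite E" and lr: "(l, r) \<in> E" and leaf: "\<And>l'. (l', r) \<in> E \<Longrightarrow> l' = l"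
  shows "card (hall_vectors E) = card (hall_vectors (E - {(l, r)})) + card (hall_vectors (E - {l} \<times> UNIV))"
proof -
  let ?E1 = "E - {(l, r)}" and ?E0 = "E - {l} \<times> UNIV"
  let ?up = "\<lambda>b. b(l := Suc (b l))"
  have fin: "finite ?E1" "finite ?E0" using E by auto
  have card1: "card (E `` J) = Suc (card (?E1 `` J))" if "l \<in> J" for J
  proof -
    have "E `` J = insert r (?E1 `` J)" "r \<notin> ?E1 `` J" using that lr by (auto dest: leaf)
    then show ?thesis using fin by simp
  qed
  have card0: "E `` J = ?E1 `` J" if "l \<notin> J" for J using that by auto
  have sum1: "sum (?up b) J = Suc (sum b J)" if "finite J" "l \<in> J" for b J
    using that by (simp add: sum.remove[of J l])
  have sum0: "sum (?up b) J = sum b J" if "l \<notin> J" for b J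
    using that by (intro sum.cong) auto
  have "sum (?up b) J \<le> card (E `` J) \<longleftrightarrow> sum b J \<le> card (?E1 `` J)" if "finite J" for b J
    using that card1[of J] card0[of J] sum1[of J b] sum0[of J b] by (cases "l \<in> J") simp_all
  then have up: "?up b \<in> hall_vectors E \<longleftrightarrow> b \<in> hall_vectors ?E1" for b
    unfolding hall_vectors_def by simp
  have zero: "b l = 0" if "b \<in> hall_vectors ?E0" for b
    using that by (rule hall_vectors_zero) auto
  have "b \<in> hall_vectors ?E0" if "b \<in> hall_vectors E" "b l = 0" for b
    unfolding hall_vectors_def
  proof safe
    fix J :: "'a set" assume J: "finite J"
    have "sum b J = sum b (J - {l})" using that(2) J by (intro sum.mono_neutral_right) auto
    also have "\<dots> \<le> card (E `` (J - {l}))" using that(1) J by (intro hall_vectorsD) auto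
    also have "E `` (J - {l}) = ?E0 `` J" by auto
    finally show "sum b J \<le> card (?E0 `` J)" .
  qed
  moreover have "b \<in> ?up ` hall_vectors ?E1" if "b \<in> hall_vectors E" "b l \<noteq> 0" for b
  proof (rule image_eqI)
    show eq: "b = ?up (b(l := b l - 1))" using that(2) by (auto simp: fun_eq_iff)
    show "b(l := b l - 1) \<in> hall_vectors ?E1"
      using that(1) up[of "b(l := b l - 1)"] eq by simp
  qed
  ultimately have "hall_vectors E = ?up ` hall_vectors ?E1 \<union> hall_vectors ?E0"
    using up hall_vectors_mono[OF E, of ?E0] by (intro equalityI subsetI) auto
  moreover have "?up ` hall_vectors ?E1 \<inter> hall_vectors ?E0 = {}" by (auto dest: zero)
  moreover have "inj ?up"
  proof (intro injI ext)
    fix a b x assume "?up a = ?up b"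
    from fun_cong[OF this, of x] show "a x = b x" by (simp split: if_splits)
  qed
  ultimately show ?thesis
    using fin by (simp add: card_Un_disjoint finite_hall_vectors card_image inj_on_subset)
qed

text \<open>In the transpose \<open>r\<close> has the single neighbour \<open>l\<close>, so its
  value is 0 or 1. The value 0 leaves the Hall vectors without the edge; the value 1 uses up
  \<open>l\<close> and leaves those of the graph without \<open>l\<close>. The summands match those
  of \<open>card_hall_vectors_leaf\<close>.\<close>

lemma card_hall_vectors_converse_leaf:
  assumes E: "finite E" and lr: "(l, r) \<in> E" and leaf: "\<And>l'. (l', r) \<in> E \<Longrightarrow> l' = l"
  shows "card (hall_vectors (E\<inverse>)) =
    card (hall_vectors ((E - {(l, r)})\<inverse>)) + card (hall_vectors ((E - {l} \<times> UNIV)\<inverse>))"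
proof -
  let ?E1 = "E - {(l, r)}" and ?E0 = "E - {l} \<times> UNIV"
  have fin: "finite (E\<inverse>)" "finite (?E1\<inverse>)" "finite (?E0\<inverse>)" using E by auto
  have card1: "card (E\<inverse> `` (insert r I)) = Suc (card (?E0\<inverse> `` I))" for I
  proof -
    have "E\<inverse> `` (insert r I) = insert l (?E0\<inverse> `` I)" "l \<notin> ?E0\<inverse> `` I" using lr by (auto dest: leaf)
    then show ?thesis using fin by simp
  qed
  have zero: "y r = 0" if "y \<in> hall_vectors (?E0\<inverse>) \<or> y \<in> hall_vectors (?E1\<inverse>)" for y
  proof (rule disjE[OF that])
    show "y r = 0" if "y \<in> hall_vectors (?E0\<inverse>)"
      using that by (rule hall_vectors_zero) (auto dest: leaf)
    show "y r = 0" if "y \<in> hall_vectors (?E1\<inverse>)"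
      using that by (rule hall_vectors_zero) (auto dest: leaf)
  qed
  have "y \<in> hall_vectors (?E1\<inverse>)" if "y \<in> hall_vectors (E\<inverse>)" "y r = 0" for y
    unfolding hall_vectors_def
  proof safe
    fix I :: "'b set" assume I: "finite I"
    have "sum y I = sum y (I - {r})" using that(2) I by (intro sum.mono_neutral_right) auto
    also have "\<dots> \<le> card (E\<inverse> `` (I - {r}))" using that(1) I by (intro hall_vectorsD) auto
    also have "\<dots> \<le> card (?E1\<inverse> `` I)" using fin by (intro card_mono) auto
    finally show "sum y I \<le> card (?E1\<inverse> `` I)" .
  qed
  moreover have "y \<in> (\<lambda>y. y(r := 1)) ` hall_vectors (?E0\<inverse>)" if "y \<in> hall_vectors (E\<inverse>)" "y r \<noteq> 0" for y
  proof (rule image_eqI)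
    have "y r \<le> card (E\<inverse> `` {r})" using hall_vectorsD[OF that(1), of "{r}"] by simp
    also have "\<dots> = 1" using card1[of "{}"] by simp
    finally have 1: "y r = 1" using that(2) by simp
    then show "y = (y(r := 0))(r := 1)" by auto
    show "y(r := 0) \<in> hall_vectors (?E0\<inverse>)"
      unfolding hall_vectors_def
    proof safe
      fix I :: "'b set" assume I: "finite I"
      have "Suc (sum (y(r := 0)) I) = Suc (sum (y(r := 0)) (I - {r}))"
        using I by (intro arg_cong[of _ _ Suc] sum.mono_neutral_right) auto
      also have "\<dots> = Suc (sum y (I - {r}))" by (intro arg_cong[of _ _ Suc] sum.cong) auto
      also have "\<dots> = sum y (insert r I)" using I 1 by (simp add: sum.insert_remove)
      also have "\<dots> \<le> Suc (card (?E0\<inverse> `` I))"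
        using hall_vectorsD[OF that(1), of "insert r I"] I card1 by simp
      finally show "sum (y(r := 0)) I \<le> card (?E0\<inverse> `` I)" by simp
    qed
  qed
  moreover have "y(r := 1) \<in> hall_vectors (E\<inverse>)" if y: "y \<in> hall_vectors (?E0\<inverse>)" for y
    unfolding hall_vectors_def
  proof safe
    fix I :: "'b set" assume I: "finite I"
    show "sum (y(r := 1)) I \<le> card (E\<inverse> `` I)"
    proof (cases "r \<in> I")
      case True
      have "sum (y(r := 1)) I = Suc (sum y (I - {r}))" using True I by (simp add: sum.remove[of I r])
      also have "\<dots> \<le> Suc (card (?E0\<inverse> `` (I - {r})))" using hall_vectorsD[OF y, of "I - {r}"] I by simp
      also have "\<dots> = card (E\<inverse> `` I)" using card1[of "I - {r}"] True by (simp add: insert_absorb)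
      finally show ?thesis .
    next
      case False
      then have "sum (y(r := 1)) I = sum y I" by (intro sum.cong) auto
      also have "\<dots> \<le> card (?E0\<inverse> `` I)" using y I by (rule hall_vectorsD)
      also have "\<dots> \<le> card (E\<inverse> `` I)" using fin by (intro card_mono) auto
      finally show ?thesis .
    qed
  qed
  ultimately have "hall_vectors (E\<inverse>) =
      hall_vectors (?E1\<inverse>) \<union> (\<lambda>y. y(r := 1)) ` hall_vectors (?E0\<inverse>)"
    using hall_vectors_mono[OF fin(1), of "?E1\<inverse>"] by (intro equalityI subsetI) auto
  moreover have "hall_vectors (?E1\<inverse>) \<inter> (\<lambda>y. y(r := 1)) ` hall_vectors (?E0\<inverse>) = {}"
  proof -
    have "y \<notin> (\<lambda>y. y(r := 1)) ` A" if "y r = 0" for y :: "'b \<Rightarrow> nat" and A using that by auto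
    then show ?thesis using zero by blast
  qed
  moreover have "inj_on (\<lambda>y. y(r := 1)) (hall_vectors (?E0\<inverse>))"
  proof (rule inj_onI)
    fix y z assume "y \<in> hall_vectors (?E0\<inverse>)" "z \<in> hall_vectors (?E0\<inverse>)" and eq: "y(r := 1) = z(r := 1)"
    then have "y r = z r" using zero[of y] zero[of z] by simp
    show "y = z"
    proof
      fix x from fun_cong[OF eq, of x] show "y x = z x" using \<open>y r = z r\<close> by (simp split: if_splits)
    qed
  qed
  ultimately show ?thesis
    using fin by (simp add: card_Un_disjoint finite_hall_vectors card_image)
qed

text \<open>Without leaves one can walk along \<open>l 0\<close>, \<open>r 0\<close>,
  \<open>l 1\<close>, \<open>r 1\<close>, ... and never turn back. The graph is finite, so some
  vertex repeats, and the first repetition closes a cycle; whether it is a left or a right vertex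
  decides how the chain is indexed.\<close>

lemma obtain_cycle:
  assumes E: "finite E" "E \<noteq> {}"
    and L: "\<And>l r. (l, r) \<in> E \<Longrightarrow> \<exists>l'. l' \<noteq> l \<and> (l', r) \<in> E"
    and R: "\<And>l r. (l, r) \<in> E \<Longrightarrow> \<exists>r'. r' \<noteq> r \<and> (l, r') \<in> E"
  obtains l r k where "edge_chain E l r k" "2 \<le> k" "(l 0, r (k - 1)) \<in> E"
proof -
  have "\<exists>f. \<forall>n. f n \<in> E \<and>
      (fst (f (Suc n)) \<noteq> fst (f n) \<and> snd (f (Suc n)) \<noteq> snd (f n) \<and> (fst (f (Suc n)), snd (f n)) \<in> E)"
  proof (rule dependent_nat_choice)
    show "\<exists>x. x \<in> E" using E(2) by auto
    fix x and n :: nat assume "x \<in> E"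
    then show "\<exists>y. y \<in> E \<and> (fst y \<noteq> fst x \<and> snd y \<noteq> snd x \<and> (fst y, snd x) \<in> E)"
      using L R by (metis fst_conv prod.collapse snd_conv)
  qed
  then obtain f where f: "\<And>n. f n \<in> E" "\<And>n. fst (f (Suc n)) \<noteq> fst (f n)"
    "\<And>n. snd (f (Suc n)) \<noteq> snd (f n)" "\<And>n. (fst (f (Suc n)), snd (f n)) \<in> E" by blast
  define l r where "l = fst \<circ> f" and "r = snd \<circ> f"
  have e: "(l n, r n) \<in> E" "(l (Suc n), r n) \<in> E" "l (Suc n) \<noteq> l n" "r (Suc n) \<noteq> r n" for n
    using f[of n] by (simp_all add: l_def r_def)
  have repeat: "\<exists>n. l n \<in> l ` {..<n} \<or> r n \<in> r ` {..<n}"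
  proof (rule ccontr)
    assume new: "\<not> ?thesis"
    have "l m \<noteq> l n" if "m < n" for m n
    proof
      assume "l m = l n"
      then have "l n \<in> l ` {..<n}" using that by (intro image_eqI[of _ _ m]) auto
      then show False using new by blast
    qed
    then have "inj l" by (rule linorder_injI)
    moreover have "finite (range l)"
      using finite_subset[of "range l" "Domain E"] E(1) e(1) by (auto simp: finite_Domain)
    ultimately show False using finite_imageD[of l UNIV] infinite_UNIV_nat by simp
  qed
  define n where "n = (LEAST n. l n \<in> l ` {..<n} \<or> r n \<in> r ` {..<n})"
  have n: "l n \<in> l ` {..<n} \<or> r n \<in> r ` {..<n}"
    unfolding n_def using repeat by (rule LeastI_ex)
  have min: "l i \<noteq> l j" "r i \<noteq> r j" if "i < j" "j < n" for i j
    using not_less_Least[of j "\<lambda>n. l n \<in> l ` {..<n} \<or> r n \<in> r ` {..<n}"] that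
    unfolding n_def[symmetric] by (metis imageI lessThan_iff)+
  consider p where "p < n" "l p = l n" | p where "p < n" "r p = r n" "l n \<notin> l ` {..<n}"
    using n by fastforce
  then show thesis
  proof cases
    \<comment> \<open>The walk returns to \<open>l p\<close> at \<open>l n\<close>: the chain takes
      the indices \<open>p\<close> to \<open>n - 1\<close>, and the edge from \<open>l n\<close> to
      \<open>r (n - 1)\<close> closes it. Its length \<open>n - p\<close> is at least 2 since
      consecutive vertices differ.\<close>
    case 1
    have "edge_chain E (\<lambda>i. l (p + i)) (\<lambda>i. r (p + i)) (n - p)"
      unfolding edge_chain_def
    proof (intro conjI allI impI inj_onI)
      fix i j assume "i \<in> {..<n - p}" "j \<in> {..<n - p}"
      then have ij: "p + i < n" "p + j < n" by auto
      show "i = j" if "l (p + i) = l (p + j)"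
        using min(1)[of "p + i" "p + j"] min(1)[of "p + j" "p + i"] ij that by (cases i j rule: linorder_cases) auto
      show "i = j" if "r (p + i) = r (p + j)"
        using min(2)[of "p + i" "p + j"] min(2)[of "p + j" "p + i"] ij that by (cases i j rule: linorder_cases) auto
    qed (auto simp: e)
    moreover have "n \<noteq> Suc p" using 1 e(3)[of p] by auto
    moreover have "(l (p + 0), r (p + (n - p - 1))) \<in> E" using e(2)[of "n - 1"] 1 by simp
    ultimately show thesis using that[of "\<lambda>i. l (p + i)" "\<lambda>i. r (p + i)" "n - p"] 1(1) by auto
  next
    \<comment> \<open>Here \<open>r n\<close> returns to \<open>r p\<close>, so the chain is shifted
      by one: it takes the indices \<open>Suc p\<close> to \<open>n\<close>, with distinct left
      vertices because \<open>l n\<close> is new, and the edge from \<open>l (Suc p)\<close> to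
      \<open>r p\<close> closes it.\<close>
    case 2
    have minl: "l i \<noteq> l j" if "i < j" "j \<le> n" for i j
      using min(1)[of i j] that 2(3) by (metis imageI le_neq_implies_less lessThan_iff)
    have minr: "r i \<noteq> r j" if "p < i" "i < j" "j \<le> n" for i j
      using min(2)[of i j] min(2)[of p i] that 2(2) by (metis le_neq_implies_less)
    have "edge_chain E (\<lambda>i. l (Suc p + i)) (\<lambda>i. r (Suc p + i)) (n - p)"
      unfolding edge_chain_def
    proof (intro conjI allI impI inj_onI)
      fix i j assume "i \<in> {..<n - p}" "j \<in> {..<n - p}"
      then have ij: "p + i < n" "p + j < n" by auto
      show "i = j" if "l (Suc p + i) = l (Suc p + j)"
        using minl[of "Suc p + i" "Suc p + j"] minl[of "Suc p + j" "Suc p + i"] ij that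
        by (cases i j rule: linorder_cases) auto
      show "i = j" if "r (Suc p + i) = r (Suc p + j)"
        using minr[of "Suc p + i" "Suc p + j"] minr[of "Suc p + j" "Suc p + i"] ij that
        by (cases i j rule: linorder_cases) auto
    qed (use e in auto)
    moreover have "n \<noteq> Suc p" using 2 e(4)[of p] by auto
    moreover have "(l (Suc p + 0), r (Suc p + (n - p - 1))) \<in> E" using e(2)[of p] 2 by simp
    ultimately show thesis using that[of "\<lambda>i. l (Suc p + i)" "\<lambda>i. r (Suc p + i)" "n - p"] 2(1) by auto
  qed
qed

section \<open>Equality of the Hall vector counts of a graph and its transpose\<close>

lemma hall_vectors_empty: "hall_vectors {} = {\<lambda>_. 0}"
proof
  show "hall_vectors {} \<subseteq> {\<lambda>_. 0}" by (auto intro: hall_vectors_zero)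
qed (simp add: hall_vectors_def)

theorem card_hall_vectors_converse:
  assumes "finite E"
  shows "card (hall_vectors (E\<inverse>)) = card (hall_vectors E)"
  using assms
proof (induction E rule: finite_psubset_induct)
  case (psubset E)
  note E = \<open>finite E\<close>
  consider "E = {}" | l r where "(l, r) \<in> E" "\<And>l'. (l', r) \<in> E \<Longrightarrow> l' = l"
    | l r where "(l, r) \<in> E" "\<And>r'. (l, r') \<in> E \<Longrightarrow> r' = r"
    | "E \<noteq> {}" "\<And>l r. (l, r) \<in> E \<Longrightarrow> \<exists>l'. l' \<noteq> l \<and> (l', r) \<in> E"
      "\<And>l r. (l, r) \<in> E \<Longrightarrow> \<exists>r'. r' \<noteq> r \<and> (l, r') \<in> E"
    by metis
  then show ?case
  proof cases
    case 1
    then show ?thesis by (simp add: hall_vectors_empty)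
  next
    case 2
    have "E - {(l, r)} \<subset> E" "E - {l} \<times> UNIV \<subset> E" using 2(1) by auto
    then show ?thesis
      using card_hall_vectors_leaf[OF E 2] card_hall_vectors_converse_leaf[OF E 2] psubset.IH by simp
  next
    case 3
    have "E - {(l, r)} \<subset> E" "E - UNIV \<times> {r} \<subset> E" using 3(1) by auto
    moreover have D: "E\<inverse> - {(r, l)} = (E - {(l, r)})\<inverse>" "E\<inverse> - {r} \<times> UNIV = (E - UNIV \<times> {r})\<inverse>"
      by auto
    have conv: "finite (E\<inverse>)" "(r, l) \<in> E\<inverse>" using E 3(1) by auto
    have leaf: "r' = r" if "(r', l) \<in> E\<inverse>" for r' using 3(2) that by blast
    moreover note card_hall_vectors_leaf[OF conv leaf, unfolded D]
      card_hall_vectors_converse_leaf[OF conv leaf, unfolded D converse_converse]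
    ultimately show ?thesis
      using psubset.IH[of "E - {(l, r)}"] psubset.IH[of "E - UNIV \<times> {r}"] by simp
  next
    case 4
    then obtain l r k where "edge_chain E l r k" "2 \<le> k" "(l 0, r (k - 1)) \<in> E"
      using obtain_cycle[OF E] by metis
    from card_hall_vectors_cycle[OF E this] psubset.IH show ?thesis by metis
  qed
qed

section \<open>Integral transport\<close>

text \<open>Integral supply-demand theorem, proved by sending one unit at a time. A unit from
  \<open>l\<close> to \<open>r\<close> can harm the condition only at a tight set that omits
  \<open>l\<close> but is adjacent to \<open>r\<close>, so it suffices to find a neighbour
  \<open>r\<close> of \<open>l\<close> with positive demand that is adjacent to no such set.\<close>

lemma transport_exists:
  fixes x :: "'a \<Rightarrow> nat" and y :: "'b \<Rightarrow> nat"
  assumes A: "finite A" and B: "finite B" and E: "E \<subseteq> A \<times> B"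
    and "sum x A = sum y B" "\<And>J. J \<subseteq> A \<Longrightarrow> sum x J \<le> sum y (E `` J)"
  shows "\<exists>\<phi>. (\<forall>i\<in>A. (\<Sum>j\<in>B. \<phi> (i, j)) = x i) \<and> (\<forall>j\<in>B. (\<Sum>i\<in>A. \<phi> (i, j)) = y j) \<and>
    (\<forall>p. p \<notin> E \<longrightarrow> \<phi> p = (0::nat))"
  using assms(4,5)
proof (induction "sum x A" arbitrary: x y)
  case 0
  then have "x i = 0" if "i \<in> A" for i using A that by simp
  moreover have "y j = 0" if "j \<in> B" for j using 0 B that by simp
  ultimately show ?case by (intro exI[of _ "\<lambda>_. 0"]) simp
next
  case (Suc t)
  have finB: "finite (E `` J)" for J using E B by (auto intro: finite_subset[of _ B])
  have hall: "sum x J \<le> sum y (E `` J)" if "J \<subseteq> A" for J using Suc.prems(2) that .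
  obtain l where l: "l \<in> A" "x l > 0"
    using Suc.hyps(2) A by (metis gr_zeroI nat.distinct(1) sum.neutral)
  have "\<exists>r. (l, r) \<in> E \<and> y r > 0 \<and> (\<forall>J. J \<subseteq> A - {l} \<and> sum x J = sum y (E `` J) \<longrightarrow> r \<notin> E `` J)"
  proof (rule ccontr)
    assume neg: "\<not> ?thesis"
    \<comment> \<open>The union of the tight sets is tight and absorbs all neighbours of \<open>l\<close> with positive demand.\<close>
    define \<T> where "\<T> = {J. J \<subseteq> A - {l} \<and> sum x J = sum y (E `` J)}"
    \<comment> \<open>Tight sets are closed under union, since the demand of the neighbourhood is
      submodular in \<open>J\<close>.\<close>
    have "\<Union>\<S> \<in> \<T>" if "finite \<S>" "\<S> \<subseteq> \<T>" for \<S>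
      using that
    proof (induction \<S>)
      case empty then show ?case by (simp add: \<T>_def)
    next
      case (insert J \<S>)
      let ?K = "\<Union>\<S>"
      have J: "J \<subseteq> A - {l}" "sum x J = sum y (E `` J)" and K: "?K \<subseteq> A - {l}" "sum x ?K = sum y (E `` ?K)"
        using insert by (auto simp: \<T>_def)
      have fin: "finite J" "finite ?K" using J(1) K(1) A by (auto intro: finite_subset)
      have "sum x (J \<union> ?K) + sum x (J \<inter> ?K) = sum x J + sum x ?K"
        using fin by (rule sum.union_inter)
      moreover have "sum y (E `` J \<union> E `` ?K) + sum y (E `` J \<inter> E `` ?K) = sum y (E `` J) + sum y (E `` ?K)"
        using finB finB by (rule sum.union_inter)
      moreover have "sum y (E `` (J \<inter> ?K)) \<le> sum y (E `` J \<inter> E `` ?K)"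
        using finB by (intro sum_mono2) auto
      moreover have "sum x (J \<inter> ?K) \<le> sum y (E `` (J \<inter> ?K))" "sum x (J \<union> ?K) \<le> sum y (E `` (J \<union> ?K))"
        using J(1) K(1) by (auto intro!: hall)
      ultimately have "sum x (J \<union> ?K) = sum y (E `` (J \<union> ?K))"
        using J(2) K(2) by (simp add: Image_Un)
      then show ?case using J(1) K(1) by (auto simp: \<T>_def)
    qed
    moreover have "finite \<T>"
      using A by (intro finite_subset[of \<T> "Pow A"]) (auto simp: \<T>_def)
    ultimately have M: "\<Union>\<T> \<in> \<T>" by blast
    then have M': "\<Union>\<T> \<subseteq> A - {l}" "sum x (\<Union>\<T>) = sum y (E `` \<Union>\<T>)" by (auto simp: \<T>_def)
    have cov: "r \<in> E `` \<Union>\<T>" if r: "(l, r) \<in> E" "y r > 0" for r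
    proof (rule ccontr)
      assume "r \<notin> E `` \<Union>\<T>"
      then have "\<forall>J. J \<subseteq> A - {l} \<and> sum x J = sum y (E `` J) \<longrightarrow> r \<notin> E `` J"
        unfolding \<T>_def by auto
      with r have "\<exists>r. (l, r) \<in> E \<and> y r > 0 \<and>
          (\<forall>J. J \<subseteq> A - {l} \<and> sum x J = sum y (E `` J) \<longrightarrow> r \<notin> E `` J)"
        by (intro exI[of _ r] conjI)
      with neg show False by (rule notE)
    qed
    \<comment> \<open>Adding \<open>l\<close> to the largest tight set raises the supply by
      \<open>x l > 0\<close> but adds only neighbours without demand.\<close>
    have "x l + sum x (\<Union>\<T>) = sum x (insert l (\<Union>\<T>))"
    proof -
      have "finite (\<Union>\<T>)" using M'(1) A by (meson finite_Diff finite_subset)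
      then show ?thesis using M'(1) by (subst sum.insert) auto
    qed
    also have "\<dots> \<le> sum y (E `` insert l (\<Union>\<T>))" using M'(1) l by (intro hall) auto
    also have "\<dots> = sum y (E `` \<Union>\<T>)"
    proof (rule sum.mono_neutral_right[OF finB])
      show "\<forall>r\<in>E `` insert l (\<Union>\<T>) - E `` \<Union>\<T>. y r = 0"
      proof
        fix r assume r: "r \<in> E `` insert l (\<Union>\<T>) - E `` \<Union>\<T>"
        then have "(l, r) \<in> E" by blast
        then show "y r = 0" using cov[of r] r by (cases "y r = 0") simp_all
      qed
    qed blast
    finally show False using l(2) M'(2) by simp
  qed
  then obtain r where r: "(l, r) \<in> E" "y r > 0"
    and tight: "\<forall>J. J \<subseteq> A - {l} \<and> sum x J = sum y (E `` J) \<longrightarrow> r \<notin> E `` J"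
    by (elim exE conjE) simp
  have rB: "r \<in> B" using r E by auto
  let ?x = "x(l := x l - 1)" and ?y = "y(r := y r - 1)"
  have sx: "sum x J = Suc (sum ?x J)" if "l \<in> J" "finite J" for J
    using that l by (simp add: sum.remove[of J l])
  have sx': "sum ?x J = sum x J" if "l \<notin> J" for J using that by (intro sum.cong) auto
  have sy: "sum y I = Suc (sum ?y I)" if "r \<in> I" "finite I" for I
    using that r by (simp add: sum.remove[of I r])
  have sy': "sum ?y I = sum y I" if "r \<notin> I" for I using that by (intro sum.cong) auto
  have "t = sum ?x A" using Suc.hyps(2) sx[of A] l A by simp
  moreover have "sum ?x A = sum ?y B" using Suc.prems(1) sx[of A] sy[of B] l A B rB by simp
  moreover have "sum ?x J \<le> sum ?y (E `` J)" if J: "J \<subseteq> A" for J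
  proof -
    have fJ: "finite J" using J A by (rule finite_subset)
    consider "l \<in> J" "r \<in> E `` J" | "l \<notin> J" "r \<notin> E `` J" | "l \<notin> J" "r \<in> E `` J"
      using r(1) by blast
    then show ?thesis
    proof cases
      case 1 then show ?thesis using hall[OF J] sx[of J] sy[of "E `` J"] fJ finB by simp
    next
      case 2 then show ?thesis using hall[OF J] sx'[of J] sy'[of "E `` J"] by simp
    next
      case 3
      then have "sum x J \<noteq> sum y (E `` J)" using tight[rule_format, of J] J by auto
      then show ?thesis using 3 hall[OF J] sx'[of J] sy[of "E `` J"] finB by simp
    qed
  qed
  ultimately obtain \<phi> where \<phi>: "\<And>i. i \<in> A \<Longrightarrow> (\<Sum>j\<in>B. \<phi> (i, j)) = ?x i"
      "\<And>j. j \<in> B \<Longrightarrow> (\<Sum>i\<in>A. \<phi> (i, j)) = ?y j" "\<And>p. p \<notin> E \<Longrightarrow> \<phi> p = 0"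
    using Suc.hyps(1)[of ?x ?y] by blast
  let ?\<phi> = "\<lambda>p. \<phi> p + of_bool (p = (l, r))"
  have "(\<Sum>j\<in>B. ?\<phi> (i, j)) = x i" if "i \<in> A" for i
  proof -
    have "(\<Sum>j\<in>B. of_bool ((i, j) = (l, r)) :: nat) = (\<Sum>j\<in>B. if j = r then of_bool (i = l) else 0)"
      by (intro sum.cong) auto
    then have "(\<Sum>j\<in>B. ?\<phi> (i, j)) = ?x i + (\<Sum>j\<in>B. if j = r then of_bool (i = l) else 0)"
      using \<phi>(1)[OF that] by (simp only: sum.distrib)
    also have "\<dots> = x i" using B rB l(2) by (simp add: sum.delta)
    finally show ?thesis .
  qed
  moreover have "(\<Sum>i\<in>A. ?\<phi> (i, j)) = y j" if "j \<in> B" for j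
  proof -
    have "(\<Sum>i\<in>A. of_bool ((i, j) = (l, r)) :: nat) = (\<Sum>i\<in>A. if i = l then of_bool (j = r) else 0)"
      by (intro sum.cong) auto
    then have "(\<Sum>i\<in>A. ?\<phi> (i, j)) = ?y j + (\<Sum>i\<in>A. if i = l then of_bool (j = r) else 0)"
      using \<phi>(2)[OF that] by (simp only: sum.distrib)
    also have "\<dots> = y j" using A l(1) r(2) by (simp add: sum.delta)
    finally show ?thesis .
  qed
  moreover have "\<forall>p. p \<notin> E \<longrightarrow> ?\<phi> p = 0" using \<phi>(3) r(1) by auto
  ultimately show ?case by (intro exI[of _ ?\<phi>]) blast
qed

section \<open>Replicating left vertices\<close>

text \<open>The number \<open>x\<close> of parts is an explicit parameter because the generating
  function below runs over it. Filling up with zeros makes the compositions into \<open>x\<close>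
  parts those into \<open>Suc x\<close> parts with last part 0.\<close>

definition weak_compositions :: "nat \<Rightarrow> nat \<Rightarrow> (nat \<Rightarrow> nat) set" where
  "weak_compositions x a = {c. (\<forall>k\<ge>x. c k = 0) \<and> sum c {..<x} = a}"

lemma weak_compositions_0: "weak_compositions 0 a = (if a = 0 then {\<lambda>_. 0} else {})"
  by (auto simp: weak_compositions_def)

lemma weak_compositions_zero: "weak_compositions x 0 = {\<lambda>_. 0}"
  by (auto simp: weak_compositions_def fun_eq_iff) (metis lessThan_iff not_le)

lemma finite_weak_compositions: "finite (weak_compositions x a)"
proof (rule finite_subset)
  show "weak_compositions x a \<subseteq> {c. \<forall>k. (k \<in> {..<x} \<longrightarrow> c k \<in> {..a}) \<and> (k \<notin> {..<x} \<longrightarrow> c k = 0)}"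
    by (auto simp: weak_compositions_def intro: member_le_sum)
qed (intro finite_set_of_finite_funs; simp)

text \<open>Pascal's rule: a positive last part is lowered by one, a zero last part is
  dropped.\<close>

lemma card_weak_compositions_Suc:
  "card (weak_compositions (Suc x) (Suc a)) = card (weak_compositions (Suc x) a) + card (weak_compositions x (Suc a))"
proof -
  let ?up = "\<lambda>c. c(x := Suc (c x))"
  have up: "?up c \<in> weak_compositions (Suc x) (Suc a) \<longleftrightarrow> c \<in> weak_compositions (Suc x) a" for c :: "nat \<Rightarrow> nat"
    by (auto simp: weak_compositions_def)
  have "c \<in> ?up ` weak_compositions (Suc x) a" if "c \<in> weak_compositions (Suc x) (Suc a)" "c x \<noteq> 0" for c
  proof (rule image_eqI)
    show eq: "c = ?up (c(x := c x - 1))" using that(2) by (auto simp: fun_eq_iff)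
    show "c(x := c x - 1) \<in> weak_compositions (Suc x) a"
      using that(1) up[of "c(x := c x - 1)"] eq by simp
  qed
  moreover have "c \<in> weak_compositions x (Suc a)" if "c \<in> weak_compositions (Suc x) (Suc a)" "c x = 0" for c
    using that by (auto simp: weak_compositions_def le_Suc_eq Suc_le_eq) (metis le_eq_less_or_eq)
  moreover have "c \<in> weak_compositions (Suc x) (Suc a)" if "c \<in> weak_compositions x (Suc a)" for c
    using that by (auto simp: weak_compositions_def)
  ultimately have "weak_compositions (Suc x) (Suc a) = ?up ` weak_compositions (Suc x) a \<union> weak_compositions x (Suc a)"
    using up by (intro equalityI subsetI) auto
  moreover have "?up ` weak_compositions (Suc x) a \<inter> weak_compositions x (Suc a) = {}"
    by (auto simp: weak_compositions_def)
  moreover have "inj ?up"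
  proof (intro injI ext)
    fix a b k assume "?up a = ?up b"
    from fun_cong[OF this, of k] show "a k = b k" by (simp split: if_splits)
  qed
  ultimately show ?thesis
    by (simp add: card_Un_disjoint finite_weak_compositions card_image inj_on_subset)
qed

text \<open>With \<open>a\<close> fixed and the number of parts varying, Pascal's rule becomes
  multiplication by \<open>1 - fps_X\<close>.\<close>

lemma fps_weak_compositions:
  "Abs_fps (\<lambda>x. real (card (weak_compositions x a))) =
     (if a = 0 then 1 else fps_X) * inverse (1 - fps_X) ^ Suc a"
proof (induction a)
  case 0
  then show ?case
    by (simp add: weak_compositions_zero fps_inverse_one_minus_fps_X fps_eq_iff) 
next
  case (Suc a)
  let ?F = "\<lambda>a. Abs_fps (\<lambda>x. real (card (weak_compositions x a)))"
  define u :: "real fps" where "u = inverse (1 - fps_X)"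
  have u: "(1 - fps_X) * u = 1" unfolding u_def by (rule inverse_mult_eq_1') simp
  \<comment> \<open>The correction for \<open>a = 0\<close> comes from the coefficient at
    \<open>x = 0\<close>: only the number 0 has a composition into no parts.\<close>
  have rec: "(1 - fps_X) * ?F (Suc a) = ?F a - of_bool (a = 0)"
  proof (rule fps_ext)
    fix x show "fps_nth ((1 - fps_X) * ?F (Suc a)) x = fps_nth (?F a - of_bool (a = 0)) x"
      by (cases x) (simp_all add: left_diff_distrib weak_compositions_0 card_weak_compositions_Suc)
  qed
  have "?F (Suc a) = ((1 - fps_X) * u) * ?F (Suc a)" by (simp only: u mult_1)
  also have "\<dots> = u * ((1 - fps_X) * ?F (Suc a))" by (simp only: mult_ac)
  also have "\<dots> = u * (?F a - of_bool (a = 0))" by (simp only: rec)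
  also have "?F a - of_bool (a = 0) = fps_X * u ^ Suc a"
  proof (cases "a = 0")
    case True
    have "u - 1 = fps_X * u" using u by (simp add: algebra_simps)
    with True show ?thesis using Suc.IH by (simp add: u_def)
  next
    case False
    then show ?thesis using Suc.IH by (simp add: u_def)
  qed
  finally show ?case by (simp add: u_def mult_ac)
qed

text \<open>With \<open>u\<close> the inverse of \<open>1 - fps_X\<close>, the relation
  \<open>fps_X * u = u - 1\<close> turns the term of index \<open>Suc a\<close> into a difference of
  consecutive powers of \<open>u\<close>.\<close>

lemma sum_fps_weak_compositions:
  "(\<Sum>a\<le>N. (if a = 0 then 1 else fps_X) * inverse (1 - fps_X) ^ Suc a) = (inverse (1 - fps_X) ^ Suc N :: real fps)"
proof (induction N)
  case (Suc N)
  define u :: "real fps" where "u = inverse (1 - fps_X)"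
  have "(1 - fps_X) * u = 1" unfolding u_def by (rule inverse_mult_eq_1') simp
  then have "1 + fps_X * u = u" by (simp add: algebra_simps)
  then have "u ^ Suc N + fps_X * u ^ Suc (Suc N) = u ^ Suc (Suc N)"
    by (metis (no_types, lifting) mult.assoc mult.commute mult.right_neutral power_Suc distrib_left)
  then show ?case using Suc by (simp add: u_def)
qed simp

section \<open>Hall vectors of a graph with replicated vertices\<close>

definition blow_up :: "('a \<Rightarrow> nat) \<Rightarrow> ('a \<times> 'b) set \<Rightarrow> (('a \<times> nat) \<times> 'b) set" where
  "blow_up x Q = {((j, k), i) | j k i. k < x j \<and> (j, i) \<in> Q}"

lemma finite_blow_up:
  assumes "finite Q"
  shows "finite (blow_up x Q)"
proof (rule finite_subset)
  show "blow_up x Q \<subseteq> (SIGMA j:Domain Q. {..<x j}) \<times> Range Q" by (auto simp: blow_up_def)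
qed (use assms in \<open>auto simp: finite_Domain finite_Range\<close>)

text \<open>The neighbourhood of \<open>I\<close> in the blow-up consists of all copies of its old
  neighbours, so cardinalities become sums of \<open>x\<close>. These are the inequalities met by
  the lattice points of the root polytope.\<close>

lemma hall_vectors_converse_blow_up:
  assumes "finite Q"
  shows "hall_vectors ((blow_up x Q)\<inverse>) = {y. \<forall>I. finite I \<longrightarrow> sum y I \<le> sum x (Q\<inverse> `` I)}"
proof -
  have "(blow_up x Q)\<inverse> `` I = (SIGMA j:Q\<inverse> `` I. {..<x j})" for I by (auto simp: blow_up_def)
  then show ?thesis using assms by (simp add: hall_vectors_def)
qed

text \<open>All copies of a vertex have the same neighbours, so the strongest conditions are those
  for sets containing every copy of the vertices they meet, and these involve only the totals over
  copies.\<close>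

lemma hall_vectors_blow_up:
  assumes Q: "finite Q"
  shows "b \<in> hall_vectors (blow_up x Q) \<longleftrightarrow>
    (\<forall>j. \<forall>k\<ge>x j. b (j, k) = 0) \<and> (\<lambda>j. \<Sum>k<x j. b (j, k)) \<in> hall_vectors Q"
proof (intro iffI conjI)
  assume b: "b \<in> hall_vectors (blow_up x Q)"
  show "\<forall>j. \<forall>k\<ge>x j. b (j, k) = 0"
    using hall_vectors_zero[OF b] by (auto simp: blow_up_def Domain_iff)
  show "(\<lambda>j. \<Sum>k<x j. b (j, k)) \<in> hall_vectors Q"
    unfolding hall_vectors_def
  proof safe
    fix J :: "'a set" assume J: "finite J"
    have "(\<Sum>j\<in>J. \<Sum>k<x j. b (j, k)) = sum b (SIGMA j:J. {..<x j})"
      using J by (simp add: sum.Sigma)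
    also have "\<dots> \<le> card (blow_up x Q `` (SIGMA j:J. {..<x j}))"
      using J by (intro hall_vectorsD[OF b]) auto
    also have "\<dots> \<le> card (Q `` J)" using Q by (intro card_mono) (auto simp: blow_up_def)
    finally show "(\<Sum>j\<in>J. \<Sum>k<x j. b (j, k)) \<le> card (Q `` J)" .
  qed
next
  assume b: "(\<forall>j. \<forall>k\<ge>x j. b (j, k) = 0) \<and> (\<lambda>j. \<Sum>k<x j. b (j, k)) \<in> hall_vectors Q"
  show "b \<in> hall_vectors (blow_up x Q)"
    unfolding hall_vectors_def
  proof safe
    fix J :: "('a \<times> nat) set" assume J: "finite J"
    let ?J = "{p \<in> J. snd p < x (fst p)}"
    let ?K = "fst ` ?J"
    have fK: "finite ?K" using J by auto
    have "b p = 0" if "\<not> snd p < x (fst p)" for p using b that by (cases p) (simp add: not_less)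
    then have "sum b J = sum b ?J" using J by (intro sum.mono_neutral_right) blast+
    also have "\<dots> \<le> sum b (SIGMA j:?K. {..<x j})"
      using fK by (intro sum_mono2) (auto simp: image_iff)
    also have "\<dots> = (\<Sum>j\<in>?K. \<Sum>k<x j. b (j, k))" using fK by (simp add: sum.Sigma)
    also have "\<dots> \<le> card (Q `` ?K)" using b fK by (intro hall_vectorsD) auto
    also have "Q `` ?K = blow_up x Q `` J" by (force simp: blow_up_def)
    finally show "sum b J \<le> card (blow_up x Q `` J)" .
  qed
qed

lemma card_hall_vectors_blow_up:
  assumes Q: "finite Q" and A: "finite A" "Domain Q \<subseteq> A"
  shows "card (hall_vectors (blow_up x Q)) =
    (\<Sum>a\<in>hall_vectors Q. \<Prod>j\<in>A. card (weak_compositions (x j) (a j)))"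
proof -
  let ?W = "\<lambda>a. {b. \<forall>j. (\<lambda>k. b (j, k)) \<in> weak_compositions (x j) (a j)}"
  \<comment> \<open>Vertices outside \<open>A\<close> have total 0 and hence only the zero
    composition, so the product may be taken over \<open>A\<close>.\<close>
  have zero: "a j = 0" if "a \<in> hall_vectors Q" "j \<notin> A" for a j
    using hall_vectors_zero[OF that(1)] that(2) A(2) by blast
  have eq: "hall_vectors (blow_up x Q) = (\<Union>a\<in>hall_vectors Q. ?W a)"
  proof (intro equalityI subsetI)
    fix b assume "b \<in> hall_vectors (blow_up x Q)"
    then show "b \<in> (\<Union>a\<in>hall_vectors Q. ?W a)"
      unfolding hall_vectors_blow_up[OF Q]
      by (intro UN_I[of "\<lambda>j. \<Sum>k<x j. b (j, k)"]) (auto simp: weak_compositions_def)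
  next
    fix b assume "b \<in> (\<Union>a\<in>hall_vectors Q. ?W a)"
    then obtain a where a: "a \<in> hall_vectors Q" "b \<in> ?W a" by blast
    then have "(\<lambda>j. \<Sum>k<x j. b (j, k)) = a" by (simp add: weak_compositions_def fun_eq_iff)
    then show "b \<in> hall_vectors (blow_up x Q)"
      using a unfolding hall_vectors_blow_up[OF Q] by (simp add: weak_compositions_def)
  qed
  have bij: "bij_betw (\<lambda>b. \<lambda>j\<in>A. \<lambda>k. b (j, k)) (?W a) (\<Pi>\<^sub>E j\<in>A. weak_compositions (x j) (a j))"
    if a: "a \<in> hall_vectors Q" for a
  proof (rule bij_betw_byWitness[where f' = "\<lambda>F (j, k). if j \<in> A then F j k else 0"])
    show "\<forall>b\<in>?W a. (\<lambda>(j, k). if j \<in> A then (\<lambda>j\<in>A. \<lambda>k. b (j, k)) j k else 0) = b"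
    proof
      fix b assume "b \<in> ?W a"
      then have "b (j, k) = 0" if "j \<notin> A" for j k
        using zero[OF a that] weak_compositions_zero[of "x j"] by (metis (mono_tags, lifting) mem_Collect_eq singletonD)
      then show "(\<lambda>(j, k). if j \<in> A then (\<lambda>j\<in>A. \<lambda>k. b (j, k)) j k else 0) = b"
        by (auto simp: fun_eq_iff)
    qed
    show "\<forall>F\<in>\<Pi>\<^sub>E j\<in>A. weak_compositions (x j) (a j).
       (\<lambda>j\<in>A. \<lambda>k. (case (j, k) of (j, k) \<Rightarrow> if j \<in> A then F j k else 0)) = F"
      by (auto simp: fun_eq_iff PiE_def extensional_def)
    show "(\<lambda>b. \<lambda>j\<in>A. \<lambda>k. b (j, k)) ` ?W a \<subseteq> (\<Pi>\<^sub>E j\<in>A. weak_compositions (x j) (a j))" by auto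
    show "(\<lambda>F (j, k). if j \<in> A then F j k else 0) ` (\<Pi>\<^sub>E j\<in>A. weak_compositions (x j) (a j)) \<subseteq> ?W a"
    proof (intro image_subsetI CollectI allI)
      fix F j assume F: "F \<in> (\<Pi>\<^sub>E j\<in>A. weak_compositions (x j) (a j))"
      show "(\<lambda>k. case (j, k) of (j, k) \<Rightarrow> if j \<in> A then F j k else 0) \<in> weak_compositions (x j) (a j)"
        using F zero[OF a, of j] by (cases "j \<in> A") (auto simp: weak_compositions_zero PiE_mem)
    qed
  qed
  have fin: "finite (?W a)" if "a \<in> hall_vectors Q" for a
    using bij_betw_finite[OF bij[OF that]] A(1) finite_weak_compositions by (simp add: finite_PiE)
  have disj: "?W a \<inter> ?W a' = {}" if "a \<noteq> a'" for a a'
    using that by (auto simp: weak_compositions_def fun_eq_iff)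
  have "card (hall_vectors (blow_up x Q)) = (\<Sum>a\<in>hall_vectors Q. card (?W a))"
    unfolding eq using fin disj by (intro card_UN_disjoint finite_hall_vectors Q) auto
  also have "\<dots> = (\<Sum>a\<in>hall_vectors Q. card (\<Pi>\<^sub>E j\<in>A. weak_compositions (x j) (a j)))"
    using bij by (intro sum.cong refl bij_betw_same_card) blast
  finally show ?thesis using A(1) by (simp add: card_PiE)
qed

lemma Union_neighbours:
  assumes "bipartite_graph m n E"
  shows "(\<Union>i\<in>J. neighbours n E i) = E `` J"
  using assms unfolding bipartite_graph_def neighbours_def by fastforce

section \<open>The generating function\<close>

text \<open>
  The augmented graph without \<open>r\<^sub>0\<close>: the coordinate \<open>y\<^sub>0\<close> of a lattice point is determined by the others.
\<close>

definition coned_edges :: "nat \<Rightarrow> (nat \<times> nat) set \<Rightarrow> (nat \<times> nat) set" where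
  "coned_edges n E = E \<union> {0} \<times> {1..n}"

context
  fixes m n :: nat and E :: "(nat \<times> nat) set"
  assumes E: "bipartite_graph m n E"
begin

lemma edge_bounds: "(i, j) \<in> E \<Longrightarrow> 1 \<le> i \<and> i \<le> m \<and> 1 \<le> j \<and> j \<le> n"
  using E by (auto simp: bipartite_graph_def)

lemma finite_coned_edges: "finite (coned_edges n E)"
  by (rule finite_subset[of _ "{0..m} \<times> {1..n}"]) (auto simp: coned_edges_def dest: edge_bounds)

text \<open>Vertex 0 sees all of \<open>{1..n}\<close>, so every set containing it has the same
  bound \<open>n\<close>, and the strongest of these conditions is the one for
  \<open>{0..m}\<close>. Sets avoiding 0 give conditions on \<open>E\<close> alone.\<close>

lemma hall_vectors_coned_edges:
  "b \<in> hall_vectors (coned_edges n E) \<longleftrightarrow>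
    (\<forall>J\<subseteq>{1..m}. sum b J \<le> card (E `` J)) \<and> b 0 + sum b {1..m} \<le> n \<and> (\<forall>j>m. b j = 0)"
proof
  assume b: "b \<in> hall_vectors (coned_edges n E)"
  have "sum b J \<le> card (E `` J)" if "J \<subseteq> {1..m}" for J
  proof -
    have "coned_edges n E `` J = E `` J" using that by (auto simp: coned_edges_def)
    moreover have "finite J" using that by (rule finite_subset) simp
    ultimately show ?thesis using hall_vectorsD[OF b] by metis
  qed
  moreover have "b 0 + sum b {1..m} \<le> n"
  proof -
    have "b 0 + sum b {1..m} = sum b (insert 0 {1..m})" by simp
    also have "\<dots> \<le> card (coned_edges n E `` insert 0 {1..m})" by (rule hall_vectorsD[OF b]) simp
    also have "\<dots> \<le> card {1..n}" by (rule card_mono) (auto simp: coned_edges_def dest: edge_bounds)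
    finally show ?thesis by simp
  qed
  moreover have "b j = 0" if "j > m" for j
    using that by (intro hall_vectors_zero[OF b]) (auto simp: coned_edges_def dest: edge_bounds)
  ultimately show "(\<forall>J\<subseteq>{1..m}. sum b J \<le> card (E `` J)) \<and> b 0 + sum b {1..m} \<le> n \<and> (\<forall>j>m. b j = 0)"
    by blast
next
  assume b: "(\<forall>J\<subseteq>{1..m}. sum b J \<le> card (E `` J)) \<and> b 0 + sum b {1..m} \<le> n \<and> (\<forall>j>m. b j = 0)"
  show "b \<in> hall_vectors (coned_edges n E)"
    unfolding hall_vectors_def
  proof safe
    fix J :: "nat set" assume J: "finite J"
    show "sum b J \<le> card (coned_edges n E `` J)"
    proof (cases "0 \<in> J")
      case True
      have "sum b J = sum b (J \<inter> insert 0 {1..m})"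
        using J b by (intro sum.mono_neutral_right) auto
      also have "\<dots> \<le> sum b (insert 0 {1..m})" by (intro sum_mono2) auto
      also have "\<dots> \<le> card {1..n}" using b by simp
      also have "\<dots> \<le> card (coned_edges n E `` J)"
        using finite_coned_edges True by (intro card_mono) (auto simp: coned_edges_def)
      finally show ?thesis .
    next
      case False
      have "b i = 0" if "i \<in> J - J \<inter> {1..m}" for i
      proof -
        have "i > m" using that False by (cases "i = 0") auto
        then show ?thesis using b by blast
      qed
      then have "sum b J = sum b (J \<inter> {1..m})" using J by (intro sum.mono_neutral_right) auto
      also have "\<dots> \<le> card (E `` (J \<inter> {1..m}))" using b by auto
      also have "\<dots> \<le> card (coned_edges n E `` J)"
        using finite_coned_edges by (intro card_mono) (auto simp: coned_edges_def)
      finally show ?thesis .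
    qed
  qed
qed

lemma sum_draconian_le: "a \<in> draconian_sequences m n E \<Longrightarrow> sum a {1..m} \<le> n"
\<comment> \<open>The draconian condition speaks of nonempty sets only, so it can be applied to
  \<open>{1..m}\<close> just for \<open>m > 0\<close>.\<close>
proof (cases "m = 0")
  case False
  assume "a \<in> draconian_sequences m n E"
  then have "sum a {1..m} \<le> card (E `` {1..m})"
    using False by (auto simp: draconian_sequences_def Union_neighbours[OF E])
  also have "\<dots> \<le> card {1..n}" by (rule card_mono) (auto dest: edge_bounds)
  finally show ?thesis by simp
qed simp

text \<open>The coordinates from 1 to \<open>m\<close> form a draconian sequence, and the only
  constraint on \<open>b 0\<close> is the bound \<open>n\<close> on the total. This free coordinate
  is the one over which the sum telescopes.\<close>

lemma bij_betw_hall_vectors_coned_edges: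
  "bij_betw (\<lambda>b. (restrict b {1..m}, b 0)) (hall_vectors (coned_edges n E))
     (SIGMA a:draconian_sequences m n E. {..n - sum a {1..m}})"
proof (rule bij_betw_byWitness[where f' = "\<lambda>(a, c) j. if j = 0 then c else if j \<le> m then a j else 0"])
  show "\<forall>b\<in>hall_vectors (coned_edges n E).
      (case (restrict b {1..m}, b 0) of (a, c) \<Rightarrow> \<lambda>j. if j = 0 then c else if j \<le> m then a j else 0) = b"
    by (auto simp: fun_eq_iff hall_vectors_coned_edges)
  show "\<forall>p\<in>SIGMA a:draconian_sequences m n E. {..n - sum a {1..m}}.
      (restrict (case p of (a, c) \<Rightarrow> \<lambda>j. if j = 0 then c else if j \<le> m then a j else 0) {1..m},
       (case p of (a, c) \<Rightarrow> \<lambda>j. if j = 0 then c else if j \<le> m then a j else 0) 0) = p"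
    by (auto simp: fun_eq_iff draconian_sequences_def PiE_def extensional_def)
  have res: "sum (restrict b {1..m}) J = sum b J" if "J \<subseteq> {1..m}" for b :: "nat \<Rightarrow> nat" and J
    using that by (intro sum.cong) auto
  show "(\<lambda>b. (restrict b {1..m}, b 0)) ` hall_vectors (coned_edges n E) \<subseteq>
      (SIGMA a:draconian_sequences m n E. {..n - sum a {1..m}})"
    using res
    by (auto simp: hall_vectors_coned_edges draconian_sequences_def Union_neighbours[OF E])
  show "(\<lambda>(a, c) j. if j = 0 then c else if j \<le> m then a j else 0) `
      (SIGMA a:draconian_sequences m n E. {..n - sum a {1..m}}) \<subseteq> hall_vectors (coned_edges n E)"
  proof (intro image_subsetI)
    fix p assume "p \<in> (SIGMA a:draconian_sequences m n E. {..n - sum a {1..m}})"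
    then obtain a c where p: "p = (a, c)" and a: "a \<in> draconian_sequences m n E" and c: "c \<le> n - sum a {1..m}"
      by auto
    let ?b = "\<lambda>j. if j = 0 then c else if j \<le> m then a j else 0"
    have s: "sum ?b J = sum a J" if "J \<subseteq> {1..m}" for J
      using that by (intro sum.cong) auto
    have h: "sum a J \<le> card (E `` J)" if "J \<subseteq> {1..m}" for J
      using a that by (cases "J = {}") (auto simp: draconian_sequences_def Union_neighbours[OF E])
    have "sum a {1..m} \<le> n" using a by (rule sum_draconian_le)
    then show "(case p of (a, c) \<Rightarrow> \<lambda>j. if j = 0 then c else if j \<le> m then a j else 0) \<in> hall_vectors (coned_edges n E)"
      unfolding p prod.case hall_vectors_coned_edges using h s c by simp
  qed
qed

section \<open>Summation over all left degree vectors\<close>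

lemma prod_fps_weak_compositions:
  "(\<Prod>j\<in>{1..m}. (if a j = 0 then 1 else fps_X) * inverse (1 - fps_X) ^ Suc (a j)) =
     (fps_X ^ num_positive m a * inverse (1 - fps_X) ^ (m + sum a {1..m}) :: real fps)"
proof -
  have "(\<Prod>j\<in>{1..m}. if a j = 0 then 1 else fps_X) = (\<Prod>j\<in>{j\<in>{1..m}. a j > 0}. fps_X :: real fps)"
    by (intro prod.mono_neutral_cong_right) auto
  then have "(\<Prod>j\<in>{1..m}. if a j = 0 then 1 else fps_X) = (fps_X ^ num_positive m a :: real fps)"
    by (simp add: num_positive_def)
  moreover have "(\<Prod>j\<in>{1..m}. u ^ Suc (a j)) = u ^ (m + sum a {1..m})" for u :: "real fps"
    by (simp add: prod.distrib power_sum power_add)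
  ultimately show ?thesis by (simp only: prod.distrib)
qed

text \<open>A multiset over \<open>{0..m}\<close> of size \<open>t\<close> encodes a left degree
  vector with sum \<open>t\<close>; \<open>fps_prod_nth'\<close> expresses the coefficients of a
  product in this indexing.\<close>

lemma sum_card_hall_vectors_converse_blow_up:
  "(\<Sum>X\<in>multisets_of_size {0..m} t. real (card (hall_vectors ((blow_up (count X) (coned_edges n E))\<inverse>)))) =
     fps_nth (fps_of_poly (support_enumerator m n E) * inverse (1 - fps_X) ^ (m + n + 1)) t"
proof -
  let ?Q = "coned_edges n E"
  let ?u = "inverse (1 - fps_X) :: real fps"
  let ?g = "\<lambda>a. (if a = 0 then 1 else fps_X) * ?u ^ Suc a"
  have dom: "Domain ?Q \<subseteq> {0..m}" by (auto simp: coned_edges_def dest: edge_bounds)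
  \<comment> \<open>Duality moves the count to the left side, where it is a product over the left
    vertices.\<close>
  have "(\<Sum>X\<in>multisets_of_size {0..m} t. real (card (hall_vectors ((blow_up (count X) ?Q)\<inverse>)))) =
      (\<Sum>X\<in>multisets_of_size {0..m} t. \<Sum>b\<in>hall_vectors ?Q.
         \<Prod>j\<in>{0..m}. real (card (weak_compositions (count X j) (b j))))"
    using finite_coned_edges
    by (simp add: card_hall_vectors_converse finite_blow_up card_hall_vectors_blow_up[OF _ _ dom])
  also have "\<dots> = (\<Sum>b\<in>hall_vectors ?Q. \<Sum>X\<in>multisets_of_size {0..m} t.
         \<Prod>j\<in>{0..m}. real (card (weak_compositions (count X j) (b j))))"
    by (rule sum.swap)
  also have "\<dots> = (\<Sum>b\<in>hall_vectors ?Q. fps_nth (\<Prod>j\<in>{0..m}. ?g (b j)) t)"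
  proof (rule sum.cong[OF refl])
    fix b :: "nat \<Rightarrow> nat"
    have "fps_nth (\<Prod>j\<in>{0..m}. ?g (b j)) t =
        fps_nth (\<Prod>j\<in>{0..m}. Abs_fps (\<lambda>x. real (card (weak_compositions x (b j))))) t"
      by (simp only: fps_weak_compositions)
    then show "(\<Sum>X\<in>multisets_of_size {0..m} t. \<Prod>j\<in>{0..m}. real (card (weak_compositions (count X j) (b j)))) =
        fps_nth (\<Prod>j\<in>{0..m}. ?g (b j)) t"
      by (simp add: fps_prod_nth')
  qed
  also have "\<dots> = fps_nth (\<Sum>b\<in>hall_vectors ?Q. \<Prod>j\<in>{0..m}. ?g (b j)) t"
    by (simp add: fps_sum_nth)
  also have "(\<Sum>b\<in>hall_vectors ?Q. \<Prod>j\<in>{0..m}. ?g (b j)) =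
      (\<Sum>b\<in>hall_vectors ?Q. (\<lambda>(a, c). ?g c * (\<Prod>j\<in>{1..m}. ?g (a j))) (restrict b {1..m}, b 0))"
  proof (rule sum.cong[OF refl])
    fix b :: "nat \<Rightarrow> nat"
    have "{0..m} = insert 0 {1..m}" by auto
    then show "(\<Prod>j\<in>{0..m}. ?g (b j)) = (\<lambda>(a, c). ?g c * (\<Prod>j\<in>{1..m}. ?g (a j))) (restrict b {1..m}, b 0)"
      by simp
  qed
  also have "\<dots> = (\<Sum>(a, c)\<in>(SIGMA a:draconian_sequences m n E. {..n - sum a {1..m}}).
      ?g c * (\<Prod>j\<in>{1..m}. ?g (a j)))"
    by (rule sum.reindex_bij_betw[OF bij_betw_hall_vectors_coned_edges])
  also have "\<dots> = (\<Sum>a\<in>draconian_sequences m n E. \<Sum>c\<le>n - sum a {1..m}. ?g c * (\<Prod>j\<in>{1..m}. ?g (a j)))"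
    by (rule sum.Sigma[symmetric]) (auto intro: finite_draconian_sequences)
  also have "\<dots> = (\<Sum>a\<in>draconian_sequences m n E. fps_X ^ num_positive m a * ?u ^ (m + n + 1))"
  proof (rule sum.cong[OF refl])
    fix a assume "a \<in> draconian_sequences m n E"
    then have le: "sum a {1..m} \<le> n" by (rule sum_draconian_le)
    \<comment> \<open>Summing over \<open>c\<close> leaves the exponent
      \<open>n - sum a {1..m} + 1\<close>; together with that of the other factors it makes the
      denominator independent of \<open>a\<close>.\<close>
    have "(\<Sum>c\<le>n - sum a {1..m}. ?g c * (\<Prod>j\<in>{1..m}. ?g (a j))) =
        ?u ^ Suc (n - sum a {1..m}) * (fps_X ^ num_positive m a * ?u ^ (m + sum a {1..m}))"
      unfolding prod_fps_weak_compositions sum_distrib_right[symmetric] sum_fps_weak_compositions ..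
    also have "\<dots> = fps_X ^ num_positive m a * ?u ^ (Suc (n - sum a {1..m}) + (m + sum a {1..m}))"
      by (simp only: power_add mult_ac)
    also have "Suc (n - sum a {1..m}) + (m + sum a {1..m}) = m + n + 1" using le by simp
    finally show "(\<Sum>c\<le>n - sum a {1..m}. ?g c * (\<Prod>j\<in>{1..m}. ?g (a j))) =
        fps_X ^ num_positive m a * ?u ^ (m + n + 1)" .
  qed
  also have "\<dots> = fps_of_poly (support_enumerator m n E) * ?u ^ (m + n + 1)"
    by (simp add: support_enumerator_def fps_of_poly_sum fps_of_poly_monom sum_distrib_right)
  finally show ?thesis .
qed

end

section \<open>The root polytope\<close>

lemma inner_Basis_enum:
  fixes e :: "'i \<Rightarrow> 'a::euclidean_space"
  assumes e: "bij_betw e A Basis" and "k \<in> A" "i \<in> A"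
  shows "e k \<bullet> e i = of_bool (i = k)"
proof -
  have "e k \<in> Basis" "e i \<in> Basis" using assms bij_betwE by blast+
  moreover have "e k = e i \<longleftrightarrow> i = k"
    using inj_on_eq_iff[OF bij_betw_imp_inj_on[OF e] assms(2,3)] by auto
  ultimately show ?thesis by (simp add: inner_Basis)
qed

lemma ball_Basis_enum:
  assumes "bij_betw e A Basis"
  shows "(\<forall>b\<in>Basis. P b) \<longleftrightarrow> (\<forall>i\<in>A. P (e i))"
  unfolding bij_betw_imp_surj_on[OF assms, symmetric] by simp

lemma sum_Basis_inner:
  fixes e :: "'i \<Rightarrow> 'a::euclidean_space"
  assumes e: "bij_betw e A Basis" and i: "i \<in> A"
  shows "(\<Sum>k\<in>A. c k *\<^sub>R e k) \<bullet> e i = c i"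
proof -
  have A: "finite A" using bij_betw_finite[OF e] by simp
  have "(\<Sum>k\<in>A. c k *\<^sub>R e k) \<bullet> e i = (\<Sum>k\<in>A. if k = i then c k else 0)"
    unfolding inner_sum_left using i by (intro sum.cong) (auto simp: inner_Basis_enum[OF e])
  then show ?thesis using A i by simp
qed

lemma sum_Basis_expansion:
  fixes e :: "'i \<Rightarrow> 'a::euclidean_space"
  assumes e: "bij_betw e A Basis"
  shows "(\<Sum>k\<in>A. (u \<bullet> e k) *\<^sub>R e k) = u"
  using sum.reindex_bij_betw[OF e, of "\<lambda>b. (u \<bullet> b) *\<^sub>R b"] by (simp add: euclidean_representation)

lemma lattice_points_Pair:
  fixes e :: "'i \<Rightarrow> 'a::euclidean_space" and f :: "'j \<Rightarrow> 'b::euclidean_space"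
  assumes "bij_betw e A Basis" "bij_betw f B Basis"
  shows "(u, v) \<in> lattice_points \<longleftrightarrow> (\<forall>i\<in>A. u \<bullet> e i \<in> \<int>) \<and> (\<forall>j\<in>B. v \<bullet> f j \<in> \<int>)"
  unfolding lattice_points_def Basis_prod_def
  by (simp add: ball_Un ball_Basis_enum[OF assms(1)] ball_Basis_enum[OF assms(2)])

text \<open>The vectors in \<open>W\<close> come from edges at the two added vertices and span all
  differences of vertices from \<open>(e 0, f 0)\<close>. There are at most \<open>m + n\<close> of
  them, and together with \<open>(e 0, 0)\<close> and \<open>(0, f 0)\<close> they span the whole
  space of dimension \<open>m + n + 2\<close>, which fixes the dimension of their span.\<close>

lemma aff_dim_root_polytope:
  fixes e :: "nat \<Rightarrow> 'a::euclidean_space" and f :: "nat \<Rightarrow> 'b::euclidean_space"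
  assumes E: "bipartite_graph m n E" and e: "bij_betw e {0..m} Basis" and f: "bij_betw f {0..n} Basis"
  shows "aff_dim (root_polytope e f (augmented_edges m n E)) = int (m + n)"
proof -
  define V where "V = {(e i, f j) | i j. (i, j) \<in> augmented_edges m n E}"
  define W where "W = (\<lambda>i. (e i - e 0, 0 :: 'b)) ` {1..m} \<union> (\<lambda>j. (0 :: 'a, f j - f 0)) ` {1..n}"
  let ?z = "(e 0, f 0)" and ?T = "\<lambda>x. - (e 0, f 0) + x"
  have bound: "i \<le> m" "j \<le> n" if "(i, j) \<in> augmented_edges m n E" for i j
    using that E by (auto simp: augmented_edges_def bipartite_graph_def)
  have left: "(e i - e 0, 0) \<in> span W" if "i \<le> m" for i
  proof (cases "i = 0")
    case True then show ?thesis using span_zero[of W] by (simp add: zero_prod_def)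
  next
    case False then show ?thesis using that by (intro span_base) (auto simp: W_def)
  qed
  have right: "(0, f j - f 0) \<in> span W" if "j \<le> n" for j
  proof (cases "j = 0")
    case True then show ?thesis using span_zero[of W] by (simp add: zero_prod_def)
  next
    case False then show ?thesis using that by (intro span_base) (auto simp: W_def)
  qed
  have "?T ` V \<subseteq> span W"
  proof
    fix w assume "w \<in> ?T ` V"
    then obtain i j where ij: "(i, j) \<in> augmented_edges m n E" and w: "w = (e i - e 0, f j - f 0)"
      by (auto simp: V_def)
    have "(e i - e 0, 0) + (0, f j - f 0) \<in> span W"
      using bound[OF ij] by (intro span_add left right)
    then show "w \<in> span W" using w by simp
  qed
  then have 1: "dim (?T ` V) \<le> dim W" by (metis dim_span dim_subset)
  have "W \<subseteq> ?T ` V"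
  proof
    fix w assume "w \<in> W"
    then consider i where "i \<in> {1..m}" "w = (e i - e 0, 0)" | j where "j \<in> {1..n}" "w = (0, f j - f 0)"
      by (auto simp: W_def)
    then show "w \<in> ?T ` V"
    proof cases
      case 1
      then have "(e i, f 0) \<in> V" by (auto simp: V_def augmented_edges_def)
      with 1 show ?thesis by (intro image_eqI[of _ _ "(e i, f 0)"]) auto
    next
      case 2
      then have "(e 0, f j) \<in> V" by (auto simp: V_def augmented_edges_def)
      with 2 show ?thesis by (intro image_eqI[of _ _ "(e 0, f j)"]) auto
    qed
  qed
  then have 2: "dim W \<le> dim (?T ` V)" by (rule dim_subset)
  have "card W \<le> m + n"
    unfolding W_def by (rule order_trans[OF card_Un_le]) (intro add_mono order_trans[OF card_image_le]; simp)
  moreover have "finite W" by (simp add: W_def)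
  ultimately have 3: "dim W \<le> m + n" using dim_le_card'[of W] by linarith
  let ?U = "insert (e 0, 0) (insert (0, f 0) W)"
  have "b \<in> span ?U" if "b \<in> Basis" for b
  proof -
    have sub: "span W \<subseteq> span ?U" by (intro span_mono) auto
    have "b \<in> (\<lambda>u. (u, 0)) ` e ` {0..m} \<union> (\<lambda>v. (0, v)) ` f ` {0..n}"
      using that unfolding Basis_prod_def bij_betw_imp_surj_on[OF e] bij_betw_imp_surj_on[OF f] .
    then consider i where "i \<le> m" "b = (e i, 0)" | j where "j \<le> n" "b = (0, f j)" by auto
    then show ?thesis
    proof cases
      case 1
      have "(e i - e 0, 0) + (e 0, 0) \<in> span ?U"
        using left[OF 1(1)] sub by (intro span_add[OF _ span_base]) auto
      with 1 show ?thesis by simp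
    next
      case 2
      have "(0, f j - f 0) + (0, f 0) \<in> span ?U"
        using right[OF 2(1)] sub by (intro span_add[OF _ span_base]) auto
      with 2 show ?thesis by simp
    qed
  qed
  then have "dim (Basis :: ('a \<times> 'b) set) \<le> dim (span ?U)" by (intro dim_subset) auto
  then have "DIM('a \<times> 'b) \<le> dim ?U"
    by (simp only: dim_span dim_eq_card_independent[OF independent_Basis])
  also have "\<dots> \<le> dim W + 2" by (auto simp: dim_insert)
  also have "DIM('a \<times> 'b) = m + n + 2"
    using bij_betw_same_card[OF e] bij_betw_same_card[OF f] by simp
  finally have "dim W = m + n" using 3 by simp
  then have "dim (?T ` V) = m + n" using 1 2 by simp
  moreover have "?z \<in> affine hull V" by (rule hull_inc) (auto simp: V_def augmented_edges_def)
  ultimately show ?thesis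
    unfolding root_polytope_def V_def[symmetric] aff_dim_convex_hull
    using aff_dim_eq_dim[of ?z V] by simp
qed

section \<open>Lattice points in the dilates of the root polytope\<close>

lemma multiset_of_function:
  assumes "finite A"
  obtains X where "\<And>i. count X i = (if i \<in> A then x i else 0)" "X \<in> multisets_of_size A (sum x A)"
proof -
  let ?X = "\<Sum>i\<in>A. replicate_mset (x i) i"
  have c: "count ?X i = (if i \<in> A then x i else 0)" for i
    using assms by (simp add: count_sum)
  then have "set_mset ?X \<subseteq> A" by (metis count_eq_zero_iff subsetI)
  then have "?X \<in> multisets_of_size A (sum x A)"
    by (simp add: multisets_of_size_def size_multiset_sum)
  with c show thesis by (rule that)
qed

lemma sum_count:
  assumes "finite A" "X \<in> multisets_of_size A t"
  shows "sum (count X) A = t"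
proof -
  have "sum (count X) A = sum (count X) (set_mset X)"
    using assms by (intro sum.mono_neutral_right) (auto simp: multisets_of_size_def not_in_iff)
  then show ?thesis using assms(2) by (simp add: multisets_of_size_def size_multiset_overloaded_eq)
qed

text \<open>The set cut out by these conditions is convex and contains every vertex of the polytope:
  an edge with right end in \<open>I\<close> has its left end in the neighbourhood of
  \<open>I\<close>. Sets containing the index 0 are left out, as \<open>r_0\<close> is adjacent to
  every left vertex.\<close>

lemma root_polytope_halfspaces:
  fixes e :: "nat \<Rightarrow> 'a::euclidean_space" and f :: "nat \<Rightarrow> 'b::euclidean_space"
  assumes E: "bipartite_graph m n E" and e: "bij_betw e {0..m} Basis" and f: "bij_betw f {0..n} Basis"
    and p: "(u, v) \<in> root_polytope e f (augmented_edges m n E)"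
  shows "\<And>i. i \<in> {0..m} \<Longrightarrow> 0 \<le> u \<bullet> e i" "\<And>j. j \<in> {0..n} \<Longrightarrow> 0 \<le> v \<bullet> f j"
    "(\<Sum>i\<in>{0..m}. u \<bullet> e i) = 1" "(\<Sum>j\<in>{0..n}. v \<bullet> f j) = 1"
    "\<And>I. I \<subseteq> {1..n} \<Longrightarrow> (\<Sum>j\<in>I. v \<bullet> f j) \<le> (\<Sum>i\<in>(coned_edges n E)\<inverse> `` I. u \<bullet> e i)"
proof -
  let ?H = "{(u, v). (\<forall>i\<in>{0..m}. 0 \<le> u \<bullet> e i) \<and> (\<forall>j\<in>{0..n}. 0 \<le> v \<bullet> f j) \<and>
    (\<Sum>i\<in>{0..m}. u \<bullet> e i) = 1 \<and> (\<Sum>j\<in>{0..n}. v \<bullet> f j) = 1 \<and>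
    (\<forall>I\<subseteq>{1..n}. (\<Sum>j\<in>I. v \<bullet> f j) \<le> (\<Sum>i\<in>(coned_edges n E)\<inverse> `` I. u \<bullet> e i))}"
  have "root_polytope e f (augmented_edges m n E) \<subseteq> ?H"
    unfolding root_polytope_def
  proof (rule hull_minimal)
    show "{(e i, f j) |i j. (i, j) \<in> augmented_edges m n E} \<subseteq> ?H"
    proof
      fix q assume "q \<in> {(e i, f j) |i j. (i, j) \<in> augmented_edges m n E}"
      then obtain k l where q: "q = (e k, f l)" and kl: "(k, l) \<in> augmented_edges m n E" by blast
      have kl': "k \<in> {0..m}" "l \<in> {0..n}"
        using kl E by (auto simp: augmented_edges_def bipartite_graph_def)
      have ek: "e k \<bullet> e i = of_bool (i = k)" if "i \<in> {0..m}" for i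
        using that kl'(1) by (rule inner_Basis_enum[OF e, rotated])
      have fl: "f l \<bullet> f j = of_bool (j = l)" if "j \<in> {0..n}" for j
        using that kl'(2) by (rule inner_Basis_enum[OF f, rotated])
      have se: "(\<Sum>i\<in>I. e k \<bullet> e i) = of_bool (k \<in> I)" if "I \<subseteq> {0..m}" for I
      proof -
        have "(\<Sum>i\<in>I. e k \<bullet> e i) = (\<Sum>i\<in>I. if i = k then 1 else 0)"
          using ek that by (intro sum.cong) auto
        then show ?thesis using finite_subset[OF that] by simp
      qed
      have sf: "(\<Sum>j\<in>I. f l \<bullet> f j) = of_bool (l \<in> I)" if "I \<subseteq> {0..n}" for I
      proof -
        have "(\<Sum>j\<in>I. f l \<bullet> f j) = (\<Sum>j\<in>I. if j = l then 1 else 0)"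
          using fl that by (intro sum.cong) auto
        then show ?thesis using finite_subset[OF that] by simp
      qed
      have "(\<Sum>j\<in>I. f l \<bullet> f j) \<le> (\<Sum>i\<in>(coned_edges n E)\<inverse> `` I. e k \<bullet> e i)" if I: "I \<subseteq> {1..n}" for I
      proof -
        have "(coned_edges n E)\<inverse> `` I \<subseteq> {0..m}"
          using E by (auto simp: coned_edges_def bipartite_graph_def)
        moreover have "l \<in> I \<Longrightarrow> k \<in> (coned_edges n E)\<inverse> `` I"
          using kl I by (auto simp: coned_edges_def augmented_edges_def)
        moreover have "I \<subseteq> {0..n}" using I by auto
        ultimately show ?thesis using se[of "(coned_edges n E)\<inverse> `` I"] sf[of I] by simp
      qed
      then show "q \<in> ?H" unfolding q using ek fl se[of "{0..m}"] sf[of "{0..n}"] kl' by simp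
    qed
    show "convex ?H"
    proof (rule convexI)
      fix p q and a b :: real assume p: "p \<in> ?H" and q: "q \<in> ?H" and ab: "0 \<le> a" "0 \<le> b" "a + b = 1"
      obtain u v u' v' where uv: "p = (u, v)" "q = (u', v')" by fastforce
      have L: "(\<Sum>i\<in>I. (a *\<^sub>R u + b *\<^sub>R u') \<bullet> e i) = a * (\<Sum>i\<in>I. u \<bullet> e i) + b * (\<Sum>i\<in>I. u' \<bullet> e i)"
        for I by (simp add: inner_add_left sum.distrib sum_distrib_left)
      have R: "(\<Sum>i\<in>I. (a *\<^sub>R v + b *\<^sub>R v') \<bullet> f i) = a * (\<Sum>i\<in>I. v \<bullet> f i) + b * (\<Sum>i\<in>I. v' \<bullet> f i)"
        for I by (simp add: inner_add_left sum.distrib sum_distrib_left)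
      have "(\<Sum>j\<in>I. (a *\<^sub>R v + b *\<^sub>R v') \<bullet> f j) \<le> (\<Sum>i\<in>(coned_edges n E)\<inverse> `` I. (a *\<^sub>R u + b *\<^sub>R u') \<bullet> e i)"
        if "I \<subseteq> {1..n}" for I
        unfolding L R using that p q ab unfolding uv by (intro add_mono mult_left_mono) auto
      moreover have "0 \<le> (a *\<^sub>R u + b *\<^sub>R u') \<bullet> e i" if "i \<in> {0..m}" for i
        using that p q ab unfolding uv by (simp add: inner_add_left)
      moreover have "0 \<le> (a *\<^sub>R v + b *\<^sub>R v') \<bullet> f i" if "i \<in> {0..n}" for i
        using that p q ab unfolding uv by (simp add: inner_add_left)
      moreover have "(\<Sum>i\<in>{0..m}. (a *\<^sub>R u + b *\<^sub>R u') \<bullet> e i) = 1" "(\<Sum>i\<in>{0..n}. (a *\<^sub>R v + b *\<^sub>R v') \<bullet> f i) = 1"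
        unfolding L R using p q ab unfolding uv by simp_all
      ultimately show "a *\<^sub>R p + b *\<^sub>R q \<in> ?H" unfolding uv by simp
    qed
  qed
  then have "(u, v) \<in> ?H" using p by blast
  then show "\<And>i. i \<in> {0..m} \<Longrightarrow> 0 \<le> u \<bullet> e i" "\<And>j. j \<in> {0..n} \<Longrightarrow> 0 \<le> v \<bullet> f j"
    "(\<Sum>i\<in>{0..m}. u \<bullet> e i) = 1" "(\<Sum>j\<in>{0..n}. v \<bullet> f j) = 1"
    "\<And>I. I \<subseteq> {1..n} \<Longrightarrow> (\<Sum>j\<in>I. v \<bullet> f j) \<le> (\<Sum>i\<in>(coned_edges n E)\<inverse> `` I. u \<bullet> e i)"
    by auto
qed

text \<open>The converse for integral points: a transport plan on the transposed graph, with
  supplies \<open>y\<close> and demands \<open>x\<close>, writes the point as a sum of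
  \<open>t\<close> vertices with repetition.\<close>

lemma in_scaled_root_polytope:
  fixes e :: "nat \<Rightarrow> 'a::euclidean_space" and f :: "nat \<Rightarrow> 'b::euclidean_space"
  assumes E: "bipartite_graph m n E"
    and x: "sum x {0..m} = t" and y: "sum y {0..n} = t"
    and hall: "\<And>I. I \<subseteq> {1..n} \<Longrightarrow> sum y I \<le> sum x ((coned_edges n E)\<inverse> `` I)"
  shows "(\<Sum>i\<in>{0..m}. real (x i) *\<^sub>R e i, \<Sum>j\<in>{0..n}. real (y j) *\<^sub>R f j) \<in>
    (\<lambda>p. real t *\<^sub>R p) ` root_polytope e f (augmented_edges m n E)"
proof -
  let ?A = "augmented_edges m n E"
  have sub: "?A\<inverse> \<subseteq> {0..n} \<times> {0..m}" using E by (auto simp: augmented_edges_def bipartite_graph_def)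
  have "sum y {0..n} = sum x {0..m}" using x y by simp
  moreover have "sum y I \<le> sum x (?A\<inverse> `` I)" if I: "I \<subseteq> {0..n}" for I
  proof (cases "0 \<in> I")
    \<comment> \<open>A set containing 0 is adjacent to every left vertex, so its condition is just
      the bound by the total \<open>t\<close>.\<close>
    case True
    then have "?A\<inverse> `` I = {0..m}" using sub by (auto simp: augmented_edges_def)
    moreover have "sum y I \<le> sum y {0..n}" using I by (intro sum_mono2) auto
    ultimately show ?thesis using x y by simp
  next
    case False
    then have I': "I \<subseteq> {1..n}" using I by (fastforce simp: Suc_le_eq intro: gr0I)
    have "sum y I \<le> sum x ((coned_edges n E)\<inverse> `` I)" using I' by (rule hall)
    also have "\<dots> \<le> sum x (?A\<inverse> `` I)"
    proof (rule sum_mono2)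
      show "finite (?A\<inverse> `` I)" using sub by (auto intro: finite_subset[of _ "{0..m}"])
      show "(coned_edges n E)\<inverse> `` I \<subseteq> ?A\<inverse> `` I"
        using I' by (auto simp: coned_edges_def augmented_edges_def)
    qed simp
    finally show ?thesis .
  qed
  ultimately obtain \<phi> where \<phi>: "\<forall>j\<in>{0..n}. (\<Sum>i\<in>{0..m}. \<phi> (j, i)) = y j"
      "\<forall>i\<in>{0..m}. (\<Sum>j\<in>{0..n}. \<phi> (j, i)) = x i" "\<forall>p. p \<notin> ?A\<inverse> \<longrightarrow> \<phi> p = (0::nat)"
    using transport_exists[OF finite_atLeastAtMost finite_atLeastAtMost sub, of y x] by metis
  have "(\<Sum>j\<in>{0..n}. \<Sum>i\<in>{0..m}. real (\<phi> (j, i)) *\<^sub>R (e i, f j)) =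
      (\<Sum>j\<in>{0..n}. (\<Sum>i\<in>{0..m}. real (\<phi> (j, i)) *\<^sub>R e i, \<Sum>i\<in>{0..m}. real (\<phi> (j, i)) *\<^sub>R f j))"
    by (simp add: sum_prod scaleR_Pair)
  also have "\<dots> = (\<Sum>j\<in>{0..n}. \<Sum>i\<in>{0..m}. real (\<phi> (j, i)) *\<^sub>R e i, \<Sum>j\<in>{0..n}. \<Sum>i\<in>{0..m}. real (\<phi> (j, i)) *\<^sub>R f j)"
    by (simp add: sum_prod)
  also have "(\<Sum>j\<in>{0..n}. \<Sum>i\<in>{0..m}. real (\<phi> (j, i)) *\<^sub>R e i) = (\<Sum>i\<in>{0..m}. real (x i) *\<^sub>R e i)"
  proof (subst sum.swap, rule sum.cong[OF refl])
    fix i assume "i \<in> {0..m}"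
    from \<phi>(2)[rule_format, OF this] show "(\<Sum>j\<in>{0..n}. real (\<phi> (j, i)) *\<^sub>R e i) = real (x i) *\<^sub>R e i"
      by (simp add: scaleR_sum_left[symmetric] flip: of_nat_sum)
  qed
  also have "(\<Sum>j\<in>{0..n}. \<Sum>i\<in>{0..m}. real (\<phi> (j, i)) *\<^sub>R f j) = (\<Sum>j\<in>{0..n}. real (y j) *\<^sub>R f j)"
  proof (rule sum.cong[OF refl])
    fix j assume "j \<in> {0..n}"
    from \<phi>(1)[rule_format, OF this] show "(\<Sum>i\<in>{0..m}. real (\<phi> (j, i)) *\<^sub>R f j) = real (y j) *\<^sub>R f j"
      by (simp add: scaleR_sum_left[symmetric] flip: of_nat_sum)
  qed
  finally have q: "(\<Sum>i\<in>{0..m}. real (x i) *\<^sub>R e i, \<Sum>j\<in>{0..n}. real (y j) *\<^sub>R f j) =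
      (\<Sum>p\<in>{0..n} \<times> {0..m}. real (\<phi> p) *\<^sub>R (e (snd p), f (fst p)))"
    by (simp add: sum.cartesian_product case_prod_unfold)
  have restr: "(\<Sum>p\<in>{0..n} \<times> {0..m}. real (\<phi> p) *\<^sub>R g p) = (\<Sum>p\<in>?A\<inverse>. real (\<phi> p) *\<^sub>R g p)"
    for g :: "nat \<times> nat \<Rightarrow> 'c::real_vector"
    using sub \<phi>(3) by (intro sum.mono_neutral_right) auto
  have tot: "(\<Sum>p\<in>?A\<inverse>. real (\<phi> p)) = real t"
  proof -
    have "(\<Sum>p\<in>{0..n} \<times> {0..m}. \<phi> p) = (\<Sum>j\<in>{0..n}. \<Sum>i\<in>{0..m}. \<phi> (j, i))"
      by (simp add: sum.cartesian_product)
    also have "\<dots> = t" using \<phi>(1) y by simp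
    finally show ?thesis using restr[of "\<lambda>_. 1 :: real"] by (simp flip: of_nat_sum)
  qed
  have fin: "finite (?A\<inverse>)" using sub by (rule finite_subset) simp
  have vert: "(e (snd p), f (fst p)) \<in> root_polytope e f ?A" if "p \<in> ?A\<inverse>" for p
    unfolding root_polytope_def using that by (intro hull_inc CollectI exI[of _ "snd p"] exI[of _ "fst p"]) auto
  show ?thesis
  proof (cases "t = 0")
    \<comment> \<open>The empty sum of vertices is the origin, obtained as 0 times a vertex; the
      convex combination below divides by \<open>t\<close>.\<close>
    case True
    then have "real (\<phi> p) = 0" if "p \<in> ?A\<inverse>" for p
      using tot fin that by (simp add: sum_nonneg_eq_0_iff)
    then have "(\<Sum>i\<in>{0..m}. real (x i) *\<^sub>R e i, \<Sum>j\<in>{0..n}. real (y j) *\<^sub>R f j) = real t *\<^sub>R (e 0, f 0)"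
      unfolding q restr using True by (simp flip: zero_prod_def)
    moreover have "(0, 0) \<in> ?A\<inverse>" by (simp add: augmented_edges_def)
    ultimately show ?thesis using vert[of "(0, 0)"] by (intro image_eqI[of _ _ "(e 0, f 0)"]) auto
  next
    case False
    have "(\<Sum>p\<in>?A\<inverse>. (real (\<phi> p) / real t) *\<^sub>R (e (snd p), f (fst p))) \<in> root_polytope e f ?A"
      using fin vert False tot unfolding root_polytope_def
      by (intro convex_sum) (auto simp: convex_convex_hull simp flip: sum_divide_distrib)
    moreover have "(\<Sum>i\<in>{0..m}. real (x i) *\<^sub>R e i, \<Sum>j\<in>{0..n}. real (y j) *\<^sub>R f j) =
       real t *\<^sub>R (\<Sum>p\<in>?A\<inverse>. (real (\<phi> p) / real t) *\<^sub>R (e (snd p), f (fst p)))"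
      unfolding q restr using False by (simp add: scaleR_sum_right)
    ultimately show ?thesis by blast
  qed
qed

lemma card_lattice_points_scaled_root_polytope:
  fixes e :: "nat \<Rightarrow> 'a::euclidean_space" and f :: "nat \<Rightarrow> 'b::euclidean_space"
  assumes E: "bipartite_graph m n E" and e: "bij_betw e {0..m} Basis" and f: "bij_betw f {0..n} Basis"
  shows "card ((\<lambda>p. real t *\<^sub>R p) ` root_polytope e f (augmented_edges m n E) \<inter> lattice_points) =
    (\<Sum>X\<in>multisets_of_size {0..m} t. card (hall_vectors ((blow_up (count X) (coned_edges n E))\<inverse>)))"
proof -
  let ?Q = "coned_edges n E"
  let ?V = "\<lambda>X. hall_vectors ((blow_up (count X) ?Q)\<inverse>)"
  let ?P = "(\<lambda>p. real t *\<^sub>R p) ` root_polytope e f (augmented_edges m n E)"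
  \<comment> \<open>The coordinate at index 0 is restored from the requirement that the right
    coordinates add up to \<open>t\<close>.\<close>
  define y' where "y' y = y(0 := t - sum y {1..n})" for y :: "nat \<Rightarrow> nat"
  define \<Phi> where "\<Phi> = (\<lambda>(X, y). (\<Sum>i\<in>{0..m}. real (count X i) *\<^sub>R e i, \<Sum>j\<in>{0..n}. real (y' y j) *\<^sub>R f j))"
  have finQ: "finite ?Q" using E by (rule finite_coned_edges)
  have QI: "?Q\<inverse> `` I \<subseteq> {0..m}" for I using E by (auto simp: coned_edges_def bipartite_graph_def)
  have VD: "sum y I \<le> sum (count X) (?Q\<inverse> `` I)" if "y \<in> ?V X" "finite I" for X y I
    using that by (simp add: hall_vectors_converse_blow_up[OF finQ])
  have V0: "y j = 0" if "y \<in> ?V X" "j \<notin> {1..n}" for X y j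
  proof -
    have "?Q\<inverse> `` {j} = {}" using that(2) E by (auto simp: coned_edges_def bipartite_graph_def)
    then show ?thesis using VD[OF that(1), of "{j}"] by simp
  qed
  have y'_sum: "sum (y' y) I = sum y I" if "I \<subseteq> {1..n}" for I y
    using that by (intro sum.cong) (auto simp: y'_def)
  have coord: "fst (\<Phi> (X, y)) \<bullet> e i = real (count X i)" if "i \<in> {0..m}" for X y i
    using sum_Basis_inner[OF e that] by (simp add: \<Phi>_def)
  have coord': "snd (\<Phi> (X, y)) \<bullet> f j = real (y' y j)" if "j \<in> {0..n}" for X y j
    using sum_Basis_inner[OF f that] by (simp add: \<Phi>_def)
  have "bij_betw \<Phi> (SIGMA X:multisets_of_size {0..m} t. ?V X) (?P \<inter> lattice_points)"
    unfolding bij_betw_def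
  proof (intro conjI equalityI subsetI)
    show "inj_on \<Phi> (SIGMA X:multisets_of_size {0..m} t. ?V X)"
    proof (rule inj_onI, clarify)
      fix X y Z w
      assume X: "X \<in> multisets_of_size {0..m} t" and y: "y \<in> ?V X"
        and Z: "Z \<in> multisets_of_size {0..m} t" and w: "w \<in> ?V Z" and eq: "\<Phi> (X, y) = \<Phi> (Z, w)"
      have "count X i = count Z i" for i
      proof (cases "i \<in> {0..m}")
        case True then show ?thesis using coord[OF True, of X y] coord[OF True, of Z w] eq by simp
      next
        case False
        then have "i \<notin># X" "i \<notin># Z" using X Z by (auto simp: multisets_of_size_def)
        then show ?thesis by (simp add: not_in_iff)
      qed
      moreover have "y j = w j" for j
      proof (cases "j \<in> {1..n}")
        case True
        then have "j \<in> {0..n}" by simp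
        then show ?thesis using coord'[of j X y] coord'[of j Z w] eq True by (simp add: y'_def)
      next
        case False then show ?thesis using V0[OF y] V0[OF w] by simp
      qed
      ultimately show "X = Z \<and> y = w" by (auto simp: multiset_eq_iff)
    qed
  next
    fix q assume "q \<in> \<Phi> ` (SIGMA X:multisets_of_size {0..m} t. ?V X)"
    then obtain X y where X: "X \<in> multisets_of_size {0..m} t" and y: "y \<in> ?V X" and q: "q = \<Phi> (X, y)"
      by auto
    have x: "sum (count X) {0..m} = t" using X by (intro sum_count) auto
    \<comment> \<open>This bound ensures that the subtraction in \<open>y'\<close> is not
      truncated.\<close>
    have "sum y {1..n} \<le> sum (count X) (?Q\<inverse> `` {1..n})" using y by (rule VD) simp
    also have "\<dots> \<le> sum (count X) {0..m}" using QI by (intro sum_mono2) auto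
    finally have le: "sum y {1..n} \<le> t" using x by simp
    have "{0..n} = insert 0 {1..n}" by auto
    then have "sum (y' y) {0..n} = t" using le y'_sum[of "{1..n}" y] by (simp add: y'_def)
    moreover have "sum (y' y) I \<le> sum (count X) (?Q\<inverse> `` I)" if "I \<subseteq> {1..n}" for I
      using VD[OF y, of I] y'_sum[OF that] finite_subset[OF that] by simp
    ultimately have "q \<in> ?P"
      unfolding q \<Phi>_def prod.case using x by (intro in_scaled_root_polytope[OF E]) auto
    moreover have "q \<in> lattice_points"
      using coord coord' unfolding q lattice_points_Pair[OF e f, of "fst (\<Phi> (X, y))" "snd (\<Phi> (X, y))", simplified]
      by simp
    ultimately show "q \<in> ?P \<inter> lattice_points" by simp
  next
    fix q assume q: "q \<in> ?P \<inter> lattice_points"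
    then obtain u v where uv: "(u, v) \<in> root_polytope e f (augmented_edges m n E)"
      and q_eq: "q = (real t *\<^sub>R u, real t *\<^sub>R v)" by auto
    note H = root_polytope_halfspaces[OF E e f uv]
    have int: "real t * (u \<bullet> e i) \<in> \<int>" if "i \<in> {0..m}" for i
      using q that unfolding q_eq Int_iff lattice_points_Pair[OF e f] by auto
    have int': "real t * (v \<bullet> f j) \<in> \<int>" if "j \<in> {0..n}" for j
      using q that unfolding q_eq Int_iff lattice_points_Pair[OF e f] by auto
    \<comment> \<open>The coordinates are nonnegative integers, so the floor changes nothing;
      \<open>y\<close> is 0 outside \<open>{1..n}\<close> because Hall vectors vanish there.\<close>
    define x where "x i = nat \<lfloor>real t * (u \<bullet> e i)\<rfloor>" for i
    define y where "y j = (if j \<in> {1..n} then nat \<lfloor>real t * (v \<bullet> f j)\<rfloor> else 0)" for j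
    have x: "real (x i) = real t * (u \<bullet> e i)" if "i \<in> {0..m}" for i
      using int[OF that] H(1)[OF that] by (simp add: x_def)
    have y: "real (y j) = real t * (v \<bullet> f j)" if "j \<in> {1..n}" for j
      using int'[of j] H(2)[of j] that by (simp add: y_def)
    have sx: "real (sum x I) = real t * (\<Sum>i\<in>I. u \<bullet> e i)" if "I \<subseteq> {0..m}" for I
      using that x by (simp add: sum_distrib_left subset_iff)
    have sy: "real (sum y I) = real t * (\<Sum>j\<in>I. v \<bullet> f j)" if "I \<subseteq> {1..n}" for I
      using that y by (simp add: sum_distrib_left subset_iff)
    have "sum x {0..m} = t" using sx[of "{0..m}"] H(3) by (simp del: of_nat_sum)
    then obtain X where X: "\<And>i. count X i = (if i \<in> {0..m} then x i else 0)" "X \<in> multisets_of_size {0..m} t"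
      using multiset_of_function[of "{0..m}" x] by auto
    have "y \<in> ?V X"
      unfolding hall_vectors_converse_blow_up[OF finQ]
    proof safe
      fix I :: "nat set" assume I: "finite I"
      let ?I = "I \<inter> {1..n}"
      have "sum y I = sum y ?I" using I by (intro sum.mono_neutral_right) (auto simp: y_def)
      also have "\<dots> \<le> sum x (?Q\<inverse> `` ?I)"
      proof -
        have "real (sum y ?I) \<le> real (sum x (?Q\<inverse> `` ?I))"
          unfolding sy[OF Int_lower2] sx[OF QI] using H(5)[of ?I] by (intro mult_left_mono) auto
        then show ?thesis by (simp only: of_nat_le_iff)
      qed
      also have "\<dots> = sum (count X) (?Q\<inverse> `` ?I)"
        using QI[of ?I] X(1) by (intro sum.cong) auto
      also have "\<dots> \<le> sum (count X) (?Q\<inverse> `` I)"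
        using finite_subset[OF QI] by (intro sum_mono2) auto
      finally show "sum y I \<le> sum (count X) (?Q\<inverse> `` I)" .
    qed
    moreover have "\<Phi> (X, y) = q"
    proof -
      have yf: "real (y' y j) = real t * (v \<bullet> f j)" if "j \<in> {0..n}" for j
      proof (cases "j = 0")
        case True
        have "{0..n} = insert 0 {1..n}" by auto
        then have 1: "v \<bullet> f 0 + (\<Sum>j\<in>{1..n}. v \<bullet> f j) = 1" using H(4) by simp
        have "real (sum y {1..n}) = real t * (1 - v \<bullet> f 0)" using sy[of "{1..n}"] 1 by simp
        then have 2: "real t - real (sum y {1..n}) = real t * (v \<bullet> f 0)" by (simp add: algebra_simps)
        have "0 \<le> real t * (v \<bullet> f 0)" using H(2)[of 0] by simp
        then have "sum y {1..n} \<le> t" using 2 by linarith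
        then have "real (y' y 0) = real t - real (sum y {1..n})" by (simp add: y'_def of_nat_diff del: of_nat_sum)
        then show ?thesis using 2 True by simp
      next
        case False then show ?thesis using y[of j] that by (simp add: y'_def)
      qed
      have "(\<Sum>i\<in>{0..m}. real (count X i) *\<^sub>R e i) = (\<Sum>i\<in>{0..m}. ((real t *\<^sub>R u) \<bullet> e i) *\<^sub>R e i)"
        using x X(1) by (intro sum.cong) auto
      moreover have "(\<Sum>j\<in>{0..n}. real (y' y j) *\<^sub>R f j) = (\<Sum>j\<in>{0..n}. ((real t *\<^sub>R v) \<bullet> f j) *\<^sub>R f j)"
        using yf by (intro sum.cong) auto
      ultimately show ?thesis
        unfolding \<Phi>_def q_eq prod.case sum_Basis_expansion[OF e] sum_Basis_expansion[OF f] by simp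
    qed
    ultimately show "q \<in> \<Phi> ` (SIGMA X:multisets_of_size {0..m} t. ?V X)"
      using X(2) by (intro image_eqI[of _ _ "(X, y)"]) auto
  qed
  then have "card (?P \<inter> lattice_points) = card (SIGMA X:multisets_of_size {0..m} t. ?V X)"
    by (rule bij_betw_same_card[symmetric])
  also have "\<dots> = (\<Sum>X\<in>multisets_of_size {0..m} t. card (?V X))"
    using finQ by (intro card_SigmaI) (auto simp: finite_hall_vectors finite_blow_up finite_multisets_of_size)
  finally show ?thesis .
qed

section \<open>Degree bound and identification of the h*-polynomial\<close>

lemma degree_support_enumerator: "degree (support_enumerator m n E) \<le> m + n"
  unfolding support_enumerator_def
proof (rule degree_sum_le[OF finite_draconian_sequences])
  fix a
  have "num_positive m a \<le> card {1..m}" unfolding num_positive_def by (rule card_mono) auto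
  then show "degree (monom (1 :: real) (num_positive m a)) \<le> m + n"
    by (intro order_trans[OF degree_monom_le]) simp
qed

theorem theorem1p2:
  fixes m n :: nat and E :: "(nat \<times> nat) set"
    and e :: "nat \<Rightarrow> 'a::euclidean_space" and f :: "nat \<Rightarrow> 'b::euclidean_space"
  assumes "bipartite_graph m n E"
    and "bij_betw e {0..m} Basis"
    and "bij_betw f {0..n} Basis"
  shows "ehrhart_series (root_polytope e f (augmented_edges m n E)) =
           fps_of_poly (support_enumerator m n E) / (1 - fps_X) ^ (m + n + 1) \<and>
         hstar_polynomial (root_polytope e f (augmented_edges m n E)) = support_enumerator m n E"
proof -
  let ?P = "root_polytope e f (augmented_edges m n E)" and ?F = "support_enumerator m n E"
  have div: "g / (1 - fps_X) ^ k = g * inverse (1 - fps_X) ^ k" for g :: "real fps" and k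
    by (simp add: fps_divide_unit fps_inverse_power)
  have ehr: "ehrhart_series ?P = fps_of_poly ?F / (1 - fps_X) ^ (m + n + 1)"
  proof (rule fps_ext)
    fix t
    have "fps_nth (ehrhart_series ?P) t =
        (\<Sum>X\<in>multisets_of_size {0..m} t. real (card (hall_vectors ((blow_up (count X) (coned_edges n E))\<inverse>))))"
      by (simp add: ehrhart_series_def card_lattice_points_scaled_root_polytope[OF assms])
    then show "fps_nth (ehrhart_series ?P) t = fps_nth (fps_of_poly ?F / (1 - fps_X) ^ (m + n + 1)) t"
      by (simp only: div sum_card_hall_vectors_converse_blow_up[OF assms(1)])
  qed
  have "hstar_polynomial ?P =
      (THE h. degree h \<le> m + n \<and> ehrhart_series ?P = fps_of_poly h / (1 - fps_X) ^ (m + n + 1))"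
    by (simp only: hstar_polynomial_def aff_dim_root_polytope[OF assms] Let_def nat_int)
  also have "\<dots> = ?F"
  proof (rule the_equality)
    show "degree ?F \<le> m + n \<and> ehrhart_series ?P = fps_of_poly ?F / (1 - fps_X) ^ (m + n + 1)"
      using ehr degree_support_enumerator by blast
    fix h assume h: "degree h \<le> m + n \<and> ehrhart_series ?P = fps_of_poly h / (1 - fps_X) ^ (m + n + 1)"
    \<comment> \<open>Uniqueness for the definite description: the power of the inverse is a nonzero
      factor and cancels, and a polynomial is determined by its power series.\<close>
    have "(inverse (1 - fps_X) :: real fps) ^ (m + n + 1) \<noteq> 0" by simp
    moreover have "fps_of_poly h * inverse (1 - fps_X) ^ (m + n + 1) = fps_of_poly ?F * inverse (1 - fps_X) ^ (m + n + 1)"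
      using h ehr by (simp only: div)
    ultimately show "h = ?F" by (metis mult_right_cancel fps_of_poly_eq_iff)
  qed
  finally show ?thesis using ehr by blast
qed

end
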